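(* The series $\sum_{n=0}^\infty(-1)^ne^{n^2/2}$ is $C$-summable, and its $C$-sum is $$C\left(\sum_{n=0}^\infty(-1)^ne^{n^2/2}\right)=\frac12.$$
   Context: **Germs and log-exp monomials.** Functions are germs at $+\infty$ on the positive real axis: two are identified if they agree for all sufficiently large real $x$. Put $\ell_0(x)=x$, $\ell_{j+1}(x)=\log\ell_j(x)$. $\mathcal P$ is the group of germs $\prod_{j=0}^r\ell_j(x)^{\alpha_j}$, $\alpha_j\in\mathbb R$. Let $\mathcal L_0=\mathcal P$. Given $\mathcal L_{\le h}=\bigcup_{q=0}^h\mathcal L_q$, a reduced exponent of height at most $h$ is a finite (possibly empty) sum $\Phi=\sum_\nu c_\nu M_\nu$ with $c_\nu\in\mathbb R\setminus\{0\}$, the $M_\nu\in\mathcal L_{\le h}$ distinct, each $M_\nu(x)\to+\infty$, and no $M_\nu$ equal to an iterated logarithm $\ell_j$ with $j\ge1$. $\mathcal L_{h+1}$ is the set of germs $\exp(\Phi(x))P(x)$ with $P\in\mathcal P$ and $\Phi$ a reduced exponent of height at most $h$; $\mathcal L=\bigcup_{h\ge0}\mathcal L_h$. The reduced expression is part of the data of an element of $\mathcal L$. Write $f\prec g$ (or $g\succ f$) if $f(x)/g(x)\to0$ as $x\to+\infty$. Let $\mathcal L_{<x}=\{L\in\mathcal L:\log L(x)=o(x)\}$. $L\in\mathcal L$ is gamma-resonant if there are $\lambda\in\mathbb R$, $H\in\mathcal L_{<x}$, $\kappa>0$ and $C\in\mathbb R_{>0}$ with $L(x)/(e^{\lambda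 x}H(x)\Gamma(\kappa x+1))\to C$. **Growth monomials, $\mathcal M$, $\mathcal M^\flat$.** A growth monomial is either a pure log-exp germ $L\in\mathcal L$ that is not gamma-resonant, or a gamma-type germ $e^{\lambda x}H(x)\Gamma(\kappa x+1)$ with $\lambda\in\mathbb R$, $H\in\mathcal L_{<x}$, $\kappa>0$. $\mathcal M$ consists of the zero germ and all finite sums $\sum_{j=1}^r(A_j+B_je^{i\pi x})M_j(x)$ with growth monomials $M_1\succ\cdots\succ M_r$ and $(A_j,B_j)\in\mathbb C^2\setminus\{(0,0)\}$. $\mathcal M^\flat$ consists of the zero germ and all finite sums $\sum_{j=1}^rC_jM_j(x)$ with growth monomials $M_1\succ\cdots\succ M_r$ and $C_j\in\mathbb C\setminus\{0\}$. The phase split of $c=\sum_j(A_j+B_je^{i\pi x})M_j\in\mathcal M$ is $c=c^{(+)}+e^{i\pi x}c^{(-)}$ with $c^{(+)}=\sum_jA_jM_j$, $c^{(-)}=\sum_jB_jM_j\in\mathcal M^\flat$. **Canonical continuation.** A growth monomial is continued to some right half-plane by replacing $x$ by $z$ in its reduced expression (principal branches of iterated logarithms and powers; for gamma-type, $M(z)=e^{\lambda z}H(z)\Gamma(\kappa z+1)$). $a=\sum C_jM_j\in\mathcal M^\flat$ is continued by $a(z)=\sum C_jM_j(z)$; the zero germ by $0$. **Bromwich transform.** $a\in\mathcal M^\flat$ is Bromwich-admissible if there is $\sigma_0\in\mathbb R$ such that for every $\sigma>\sigma_0$: (1) $\mathcal B[a](u)=\frac1{2\pi i}\int_{\sigma-i\infty}^{\sigma+i\infty}a(z)e^{-uz}\,dz$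 converges absolutely for almost every $u\in\mathbb R$; (2) $\mathcal B[a](u)$ does not depend on $\sigma>\sigma_0$; (3) for every sufficiently large integer $N$, $\int_{-\infty}^\infty\mathcal B[a](u)e^{Nu}\,du$ converges absolutely and equals $a(N)$. **Selectors.** For Bromwich-admissible $a$, $\mathcal S_+[a](N)=PV\int_{-\infty}^\infty\frac{\mathcal B[a](u)e^{Nu}}{1-e^u}du$, whenever the integral converges absolutely away from $u=0$ and the principal value $\lim_{\varepsilon\to0^+}\int_{|u|>\varepsilon}$ exists; $\mathcal S_-[a](N)=\int_{-\infty}^\infty\frac{\mathcal B[a](u)e^{Nu}}{1+e^u}du$, whenever it converges absolutely. $c\in\mathcal M$ admits a canonical selector if $c^{(\pm)}$ are Bromwich-admissible and $\mathcal S_+[c^{(+)}](N)$, $\mathcal S_-[c^{(-)}](N)$ exist for all sufficiently large $N$; then $U_c(N)=\mathcal S_+[c^{(+)}](N)+(-1)^N\mathcal S_-[c^{(-)}](N)$. **Admissibility and finite part.** A sequence $U$ (defined for large $N$) is shift-nonresonant if either $U_N\to0$ or there are $\varepsilon>0$, $N_0$ with $|U_N-U_{N+1}|\ge\varepsilon|U_N|$ for $N\ge N_0$. For a complex sequence $R=(R_N)_{N\ge0}$ put $c_N=R_N-R_{N+1}$. $R$ is $\mathcal M$-admissible if either $c_N=0$ for all large $N$, or there is $c\in\mathcal M$ with $c(N)=c_N$ for all large integers $N$ which admits a canonical selector $U_c$ that is shift-nonresonant (such $c$ is unique). For $\mathcal M$-admissible $R$, $\mathrm{FP}_\infty(R)$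 is the eventual constant value of $R_N$ if $c_N=0$ eventually, and otherwise the eventual constant value of $R_N-U_c(N)$. **$C$-summation.** A recurrence presentation of a formal series $\sum_{k\ge0}c_k$ consists of $n_0\in\mathbb N$, functions $a,b:\mathbb N\to\mathbb C$ with $a(n),b(n)\ne0$ for $n\ge n_0$, and complex $\mu_n$ such that $c_k=(-1)^k\mu_{n_0+k}\prod_{j=0}^{k-1}\frac{b(n_0+j)}{a(n_0+j+1)}$ for all $k\ge0$ (empty product $=1$). Put $P(n,n_0)=\prod_{k=n_0}^{n-1}(-a(k)/b(k))$. For a solution $(I_n)_{n\ge n_0}$ of $a(n)I_n+b(n)I_{n+1}=\mu_n$ the normalized tail is $R_N=a(n_0)I_{n_0+N}/P(n_0+N,n_0)$. The series is $C$-summable if some presentation has a solution with $\mathcal M$-admissible normalized tail $R$; its $C$-sum is then $C(\sum c_k)=a(n_0)I_{n_0}-\mathrm{FP}_\infty(R)$ (a value independent of the presentation and solution). *)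

theory Defs
  imports "HOL-Analysis.Analysis" "HOL-Library.Landau_Symbols"
begin

section \<open>Log-exp germs\<close>

text \<open>
  A reduced expression is a syntactic object: \<open>LogExp \<Phi> \<alpha>\<close> stands for
  \<open>exp (\<Sum>\<nu>. c\<^sub>\<nu> M\<^sub>\<nu>) \<cdot> (\<Prod>j. \<ell>\<^sub>j powr \<alpha>\<^sub>j)\<close>, where \<open>\<Phi>\<close> lists the pairs \<open>(c\<^sub>\<nu>, M\<^sub>\<nu>)\<close>.
  Its evaluation is polymorphic: at type \<open>real\<close> it gives (a representative of) the germ at infinity,
  at type \<open>complex\<close>, where \<open>ln\<close> and \<open>powr\<close> are the principal branches, the canonical
  continuation.  Values outside a neighbourhood of infinity (a right half-plane) are irrelevant.
\<close>

datatype logexp = LogExp "(real \<times> logexp) list" "real list"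

definition iter_ln :: "nat \<Rightarrow> 'a \<Rightarrow> 'a::ln" where
  "iter_ln j = ln ^^ j"

fun eval :: "logexp \<Rightarrow> 'a \<Rightarrow> 'a::{ln, real_normed_field}" where
  "eval (LogExp \<Phi> \<alpha>) z =
     exp (\<Sum>(c, M)\<leftarrow>\<Phi>. of_real c * eval M z) *
     (\<Prod>j<length \<alpha>. iter_ln j z powr of_real (\<alpha> ! j))"

definition germ_eq :: "(real \<Rightarrow> 'b) \<Rightarrow> (real \<Rightarrow> 'b) \<Rightarrow> bool" where
  "germ_eq f g \<longleftrightarrow> (\<forall>\<^sub>F x in at_top. f x = g x)"

definition germ_succ :: "(real \<Rightarrow> real) \<Rightarrow> (real \<Rightarrow> real) \<Rightarrow> bool" where
  "germ_succ g f \<longleftrightarrow> ((\<lambda>x. f x / g x) \<longlongrightarrow> 0) at_top"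

definition reduced_exponent :: "logexp set \<Rightarrow> (real \<times> logexp) list \<Rightarrow> bool" where
  "reduced_exponent S \<Phi> \<longleftrightarrow>
     (\<forall>(c, M)\<in>set \<Phi>. c \<noteq> 0 \<and> M \<in> S \<and> filterlim (eval M :: real \<Rightarrow> real) at_top at_top \<and>
        (\<forall>j\<ge>1. \<not> germ_eq (eval M) (iter_ln j))) \<and>
     (\<forall>i<length \<Phi>. \<forall>j<length \<Phi>. i \<noteq> j \<longrightarrow> \<not> germ_eq (eval (snd (\<Phi> ! i))) (eval (snd (\<Phi> ! j))))"

text \<open>\<open>logexp_le h\<close> is the union of the levels \<open>0, \<dots>, h\<close>.\<close>

primrec logexp_le :: "nat \<Rightarrow> logexp set" where
  "logexp_le 0 = {LogExp [] \<alpha> |\<alpha>. True}"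
| "logexp_le (Suc h) = logexp_le h \<union> {LogExp \<Phi> \<alpha> |\<Phi> \<alpha>. reduced_exponent (logexp_le h) \<Phi>}"

definition logexp_germs :: "logexp set" where
  "logexp_germs = (\<Union>h. logexp_le h)"

definition logexp_subexp :: "logexp set" where
  "logexp_subexp = {L \<in> logexp_germs. (\<lambda>x::real. ln (eval L x)) \<in> o[at_top](\<lambda>x. x)}"

section \<open>Growth monomials\<close>

datatype growth = Pure logexp | Gamma_Type real logexp real

fun growth_eval :: "growth \<Rightarrow> 'a \<Rightarrow> 'a::{ln, Gamma}" where
  "growth_eval (Pure L) z = eval L z"
| "growth_eval (Gamma_Type \<theta> H \<kappa>) z =
     exp (of_real \<theta> * z) * eval H z * Gamma (of_real \<kappa> * z + 1)"

definition gamma_resonant :: "logexp \<Rightarrow> bool" where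
  "gamma_resonant L \<longleftrightarrow>
     (\<exists>\<theta>. \<exists>H\<in>logexp_subexp. \<exists>\<kappa>>0. \<exists>C>0.
        ((\<lambda>x::real. eval L x / (exp (\<theta> * x) * eval H x * Gamma (\<kappa> * x + 1))) \<longlongrightarrow> C) at_top)"

fun growth_monomial :: "growth \<Rightarrow> bool" where
  "growth_monomial (Pure L) \<longleftrightarrow> L \<in> logexp_germs \<and> \<not> gamma_resonant L"
| "growth_monomial (Gamma_Type \<theta> H \<kappa>) \<longleftrightarrow> H \<in> logexp_subexp \<and> \<kappa> > 0"

definition growth_chain :: "growth list \<Rightarrow> bool" where
  "growth_chain Ms \<longleftrightarrow>
     (\<forall>M\<in>set Ms. growth_monomial M) \<and>
     sorted_wrt (\<lambda>M M'. germ_succ (growth_eval M) (growth_eval M')) Ms"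

text \<open>
  An element of \<open>\<M>\<close> is given by the list of its terms \<open>(A\<^sub>j, B\<^sub>j, M\<^sub>j)\<close>, an element of
  \<open>\<M>\<^sup>\<flat>\<close> by the list of its terms \<open>(C\<^sub>j, M\<^sub>j)\<close>; the empty list is the zero germ.
\<close>

type_synonym osc_sum = "(complex \<times> complex \<times> growth) list"
type_synonym flat_sum = "(complex \<times> growth) list"

definition osc_sums :: "osc_sum set" where
  "osc_sums = {c. growth_chain (map (\<lambda>(A, B, M). M) c) \<and> (\<forall>(A, B, M)\<in>set c. (A, B) \<noteq> (0, 0))}"

definition flat_sums :: "flat_sum set" where
  "flat_sums = {a. growth_chain (map snd a) \<and> (\<forall>(C, M)\<in>set a. C \<noteq> 0)}"

definition osc_germ :: "osc_sum \<Rightarrow> real \<Rightarrow> complex" where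
  "osc_germ c x = (\<Sum>(A, B, M)\<leftarrow>c. (A + B * exp (\<i> * pi * x)) * of_real (growth_eval M x))"

definition flat_germ :: "flat_sum \<Rightarrow> real \<Rightarrow> complex" where
  "flat_germ a x = (\<Sum>(C, M)\<leftarrow>a. C * of_real (growth_eval M x))"

definition flat_cont :: "flat_sum \<Rightarrow> complex \<Rightarrow> complex" where
  "flat_cont a z = (\<Sum>(C, M)\<leftarrow>a. C * growth_eval M z)"

text \<open>The two parts of the phase split; terms with coefficient \<open>0\<close> are dropped.\<close>

definition phase_plus :: "osc_sum \<Rightarrow> flat_sum" where
  "phase_plus c = filter (\<lambda>(C, M). C \<noteq> 0) (map (\<lambda>(A, B, M). (A, M)) c)"

definition phase_minus :: "osc_sum \<Rightarrow> flat_sum" where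
  "phase_minus c = filter (\<lambda>(C, M). C \<noteq> 0) (map (\<lambda>(A, B, M). (B, M)) c)"

section \<open>Bromwich transform\<close>

text \<open>The contour integrals over \<open>Re z = \<sigma>\<close>, parametrized by \<open>z = \<sigma> + \<i> t\<close>, \<open>dz = \<i> dt\<close>.\<close>

definition bromwich_integrand :: "flat_sum \<Rightarrow> real \<Rightarrow> real \<Rightarrow> real \<Rightarrow> complex" where
  "bromwich_integrand a \<sigma> u t = flat_cont a (Complex \<sigma> t) * exp (- of_real u * Complex \<sigma> t)"

definition bromwich_at :: "flat_sum \<Rightarrow> real \<Rightarrow> real \<Rightarrow> complex" where
  "bromwich_at a \<sigma> u = 1 / (2 * pi * \<i>) * (LINT t|lborel. bromwich_integrand a \<sigma> u t * \<i>)"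

definition bromwich_admissible :: "flat_sum \<Rightarrow> bool" where
  "bromwich_admissible a \<longleftrightarrow> a \<in> flat_sums \<and>
     (\<exists>\<sigma>0. \<forall>\<sigma>>\<sigma>0.
        (AE u in lborel. integrable lborel (bromwich_integrand a \<sigma> u)) \<and>
        (\<forall>\<sigma>'>\<sigma>0. \<forall>u. bromwich_at a \<sigma>' u = bromwich_at a \<sigma> u) \<and>
        (\<forall>\<^sub>F N in sequentially.
           integrable lborel (\<lambda>u. bromwich_at a \<sigma> u * exp (of_nat N * of_real u)) \<and>
           (LINT u|lborel. bromwich_at a \<sigma> u * exp (of_nat N * of_real u)) = flat_germ a (real N)))"

text \<open>The common value for all large \<open>\<sigma>\<close>; meaningful for Bromwich-admissible sums.\<close>

definition bromwich :: "flat_sum \<Rightarrow> real \<Rightarrow> complex" where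
  "bromwich a u = (THE v. \<forall>\<^sub>F \<sigma> in at_top. bromwich_at a \<sigma> u = v)"

section \<open>Selectors\<close>

definition splus_integrand :: "flat_sum \<Rightarrow> nat \<Rightarrow> real \<Rightarrow> complex" where
  "splus_integrand a N u = bromwich a u * exp (of_nat N * of_real u) / (1 - exp (of_real u))"

definition splus_cut :: "flat_sum \<Rightarrow> nat \<Rightarrow> real \<Rightarrow> complex" where
  "splus_cut a N \<epsilon> = (LINT u:{u. \<bar>u\<bar> > \<epsilon>}|lborel. splus_integrand a N u)"

definition splus_exists :: "flat_sum \<Rightarrow> nat \<Rightarrow> bool" where
  "splus_exists a N \<longleftrightarrow>
     (\<forall>\<epsilon>>0. set_integrable lborel {u. \<bar>u\<bar> > \<epsilon>} (splus_integrand a N)) \<and>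
     (\<exists>v. (splus_cut a N \<longlongrightarrow> v) (at_right 0))"

definition splus :: "flat_sum \<Rightarrow> nat \<Rightarrow> complex" where
  "splus a N = Lim (at_right 0) (splus_cut a N)"

definition sminus_integrand :: "flat_sum \<Rightarrow> nat \<Rightarrow> real \<Rightarrow> complex" where
  "sminus_integrand a N u = bromwich a u * exp (of_nat N * of_real u) / (1 + exp (of_real u))"

definition sminus_exists :: "flat_sum \<Rightarrow> nat \<Rightarrow> bool" where
  "sminus_exists a N \<longleftrightarrow> integrable lborel (sminus_integrand a N)"

definition sminus :: "flat_sum \<Rightarrow> nat \<Rightarrow> complex" where
  "sminus a N = (LINT u|lborel. sminus_integrand a N u)"

definition admits_selector :: "osc_sum \<Rightarrow> bool" where
  "admits_selector c \<longleftrightarrow>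
     bromwich_admissible (phase_plus c) \<and> bromwich_admissible (phase_minus c) \<and>
     (\<forall>\<^sub>F N in sequentially. splus_exists (phase_plus c) N \<and> sminus_exists (phase_minus c) N)"

definition selector :: "osc_sum \<Rightarrow> nat \<Rightarrow> complex" where
  "selector c N = splus (phase_plus c) N + (-1) ^ N * sminus (phase_minus c) N"

section \<open>Admissible sequences and finite part\<close>

definition shift_nonresonant :: "(nat \<Rightarrow> complex) \<Rightarrow> bool" where
  "shift_nonresonant U \<longleftrightarrow>
     U \<longlonglongrightarrow> 0 \<or>
     (\<exists>\<epsilon>>0. \<exists>N0. \<forall>N\<ge>N0. norm (U N - U (N + 1)) \<ge> \<epsilon> * norm (U N))"

definition eventually_constant :: "(nat \<Rightarrow> complex) \<Rightarrow> bool" where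
  "eventually_constant R \<longleftrightarrow> (\<forall>\<^sub>F N in sequentially. R N - R (N + 1) = 0)"

definition interpolates :: "osc_sum \<Rightarrow> (nat \<Rightarrow> complex) \<Rightarrow> bool" where
  "interpolates c R \<longleftrightarrow>
     c \<in> osc_sums \<and> (\<forall>\<^sub>F N in sequentially. osc_germ c (real N) = R N - R (N + 1)) \<and>
     admits_selector c \<and> shift_nonresonant (selector c)"

definition M_admissible :: "(nat \<Rightarrow> complex) \<Rightarrow> bool" where
  "M_admissible R \<longleftrightarrow> eventually_constant R \<or> (\<exists>c. interpolates c R)"

definition finite_part :: "(nat \<Rightarrow> complex) \<Rightarrow> complex" where
  "finite_part R =
     (if eventually_constant R then THE v. \<forall>\<^sub>F N in sequentially. R N = v
      else THE v. \<exists>c. interpolates c R \<and> (\<forall>\<^sub>F N in sequentially. R N - selector c N = v))"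

section \<open>C-summation\<close>

definition recurrence_presentation ::
  "(nat \<Rightarrow> complex) \<Rightarrow> nat \<Rightarrow> (nat \<Rightarrow> complex) \<Rightarrow> (nat \<Rightarrow> complex) \<Rightarrow> (nat \<Rightarrow> complex) \<Rightarrow> bool" where
  "recurrence_presentation c n0 a b \<mu> \<longleftrightarrow>
     (\<forall>n\<ge>n0. a n \<noteq> 0 \<and> b n \<noteq> 0) \<and>
     (\<forall>k. c k = (-1) ^ k * \<mu> (n0 + k) * (\<Prod>j<k. b (n0 + j) / a (n0 + j + 1)))"

definition recurrence_solution ::
  "nat \<Rightarrow> (nat \<Rightarrow> complex) \<Rightarrow> (nat \<Rightarrow> complex) \<Rightarrow> (nat \<Rightarrow> complex) \<Rightarrow> (nat \<Rightarrow> complex) \<Rightarrow> bool" where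
  "recurrence_solution n0 a b \<mu> I \<longleftrightarrow> (\<forall>n\<ge>n0. a n * I n + b n * I (n + 1) = \<mu> n)"

definition normalized_tail ::
  "nat \<Rightarrow> (nat \<Rightarrow> complex) \<Rightarrow> (nat \<Rightarrow> complex) \<Rightarrow> (nat \<Rightarrow> complex) \<Rightarrow> nat \<Rightarrow> complex" where
  "normalized_tail n0 a b I N = a n0 * I (n0 + N) / (\<Prod>k\<in>{n0..<n0 + N}. - a k / b k)"

definition C_value :: "(nat \<Rightarrow> complex) \<Rightarrow> complex \<Rightarrow> bool" where
  "C_value c s \<longleftrightarrow>
     (\<exists>n0 a b \<mu> I. recurrence_presentation c n0 a b \<mu> \<and> recurrence_solution n0 a b \<mu> I \<and>
        M_admissible (normalized_tail n0 a b I) \<and>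
        s = a n0 * I n0 - finite_part (normalized_tail n0 a b I))"

definition C_summable :: "(nat \<Rightarrow> complex) \<Rightarrow> bool" where
  "C_summable c \<longleftrightarrow> (\<exists>s. C_value c s)"

text \<open>
  By the definite description, an equation for \<open>C_sum c\<close> with \<open>C_summable c\<close> can only be proved by
  showing that all presentations and solutions yield the same value.
\<close>

definition C_sum :: "(nat \<Rightarrow> complex) \<Rightarrow> complex" where
  "C_sum c = (THE s. C_value c s)"

end

theory Submission
  imports Defs "HOL-Probability.Probability" "HOL-Complex_Analysis.Complex_Analysis" "HOL-Real_Asymp.Real_Asymp"
begin

text \<open>
  A linear combination of pairwise comparable germs tending to infinity is either eventually zero
  or tends to \<open>\<plusminus>\<infinity>\<close>.  Applied to logarithms of log-exp germs, by induction on the height, this shows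
  that two log-exp germs either agree or one of them dominates the other.  Hence an element of
  \<open>\<M>\<close> with values \<open>(-1)\<^sup>N exp (N\<^sup>2 / 2)\<close> at the large integers is a single term
  \<open>e\<^bsup>i\<pi>x\<^esup> L\<close> with \<open>L = exp (x\<^sup>2 / 2)\<close> as real germs, whatever the expression \<open>L\<close>; by the identity
  theorem its continuation is \<open>exp (z\<^sup>2 / 2)\<close>.  The Bromwich transform is therefore the standard normal
  density \<open>\<phi>\<close>, and the selector is \<open>U\<^sub>N = (-1)\<^sup>N V\<^sub>N\<close> with
  \<open>V\<^sub>N = \<integral> \<phi>(u) exp (N u) / (1 + exp u) du\<close>.  Since \<open>V\<^sub>N + V\<^sub>N\<^sub>+\<^sub>1 = exp (N\<^sup>2 / 2)\<close>,
  the finite part of any normalized tail \<open>R\<close> is \<open>R\<^sub>0 - V\<^sub>0\<close>, and \<open>V\<^sub>0 = 1 / 2\<close> by symmetry.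
\<close>

section \<open>Comparability of germs\<close>

definition comparable :: "(real \<Rightarrow> real) \<Rightarrow> (real \<Rightarrow> real) \<Rightarrow> bool" where
  "comparable f g \<longleftrightarrow> germ_eq f g \<or> germ_succ f g \<or> germ_succ g f"

text \<open>Division by zero yields 0, so an eventually vanishing \<open>g\<close> would satisfy
  both domination hypotheses for arbitrary \<open>f\<close> and \<open>h\<close>. Eventual
  nonvanishing allows \<open>g\<close> to cancel in \<open>(h / g) * (g / f)\<close>.\<close>

lemma germ_succ_trans:
  assumes "germ_succ f g" "germ_succ g h" "\<forall>\<^sub>F x in at_top. g x \<noteq> 0"
  shows "germ_succ f h"
proof -
  have "((\<lambda>x. (h x / g x) * (g x / f x)) \<longlongrightarrow> 0 * 0) at_top"
    using assms(1,2) unfolding germ_succ_def by (intro tendsto_mult)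
  moreover have "\<forall>\<^sub>F x in at_top. (h x / g x) * (g x / f x) = h x / f x"
    using assms(3) by eventually_elim simp
  ultimately show ?thesis
    unfolding germ_succ_def using Lim_transform_eventually by fastforce
qed

section \<open>Linear combinations over a scale of comparable germs\<close>

definition linear_combination :: "(real \<times> (real \<Rightarrow> real)) list \<Rightarrow> real \<Rightarrow> real" where
  "linear_combination ps x = (\<Sum>(c, f)\<leftarrow>ps. c * f x)"

lemma linear_combination_simps [simp]:
  "linear_combination [] x = 0"
  "linear_combination ((c, f) # ps) x = c * f x + linear_combination ps x"
  "linear_combination (ps @ qs) x = linear_combination ps x + linear_combination qs x"
  by (simp_all add: linear_combination_def)

lemma linear_combination_map_scale:
  "linear_combination (map (\<lambda>(c, f). (a * c, f)) ps) x = a * linear_combination ps x"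
  by (induction ps) (auto simp: algebra_simps)

text \<open>The abstraction serves twice: for the iterated logarithms alone, and in the induction on
  the height for the germs that occur in logarithms of the next level.\<close>

locale growth_scale =
  fixes S :: "(real \<Rightarrow> real) set"
  assumes unbounded: "f \<in> S \<Longrightarrow> filterlim f at_top at_top"
    and comparable: "f \<in> S \<Longrightarrow> g \<in> S \<Longrightarrow> comparable f g"
begin

text \<open>Strict decrease together with nonzero coefficients makes the head of the list the
  leading term.\<close>

definition normal :: "(real \<times> (real \<Rightarrow> real)) list \<Rightarrow> bool" where
  "normal ps \<longleftrightarrow> (\<forall>(c, f)\<in>set ps. c \<noteq> 0 \<and> f \<in> S) \<and>
     sorted_wrt (\<lambda>p q. germ_succ (snd p) (snd q)) ps"

lemma eventually_nonzero: "f \<in> S \<Longrightarrow> \<forall>\<^sub>F x in at_top. f x \<noteq> 0"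
  using unbounded filterlim_at_top_dense[of f at_top] by (fastforce elim: eventually_mono)

text \<open>Insertion sort by dominance: equal germs are merged, possibly cancelling, a dominating
  germ goes in front, and a dominated one is passed down the list. The inclusion of the germs of
  \<open>qs\<close> is carried along so that in the last case the old head is known to dominate
  everything in the new tail.\<close>

lemma normal_insert:
  assumes "normal ps" "f \<in> S" "c \<noteq> 0"
  shows "\<exists>qs. normal qs \<and> snd ` set qs \<subseteq> insert f (snd ` set ps) \<and>
    germ_eq (linear_combination qs) (\<lambda>x. c * f x + linear_combination ps x)"
  using assms(1)
proof (induction ps)
  case Nil
  show ?case
    using assms by (intro exI[of _ "[(c, f)]"]) (auto simp: normal_def germ_eq_def)
next
  case (Cons p ps)
  obtain d g where p: "p = (d, g)" by force
  have norm: "normal ps" and g: "g \<in> S" "d \<noteq> 0"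
    and gs: "\<And>q. q \<in> set ps \<Longrightarrow> germ_succ g (snd q)"
    using Cons.prems p by (auto simp: normal_def)
  from comparable[OF assms(2) g(1)] consider "germ_eq f g" | "germ_succ f g" | "germ_succ g f"
    unfolding comparable_def by blast
  then show ?case
  proof cases
    case 1
    show ?thesis
    proof (cases "c + d = 0")
      case True
      have "germ_eq (linear_combination ps) (\<lambda>x. c * f x + linear_combination (p # ps) x)"
        using 1 unfolding germ_eq_def p
      proof eventually_elim
        case (elim x)
        then have "c * f x + d * g x = (c + d) * g x" by (simp add: algebra_simps)
        with True show ?case by simp
      qed
      with norm show ?thesis by (intro exI[of _ ps]) auto
    next
      case False
      have "germ_eq (linear_combination ((c + d, g) # ps)) (\<lambda>x. c * f x + linear_combination (p # ps) x)"
        using 1 unfolding germ_eq_def p by eventually_elim (simp add: algebra_simps)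
      with False Cons.prems show ?thesis
        by (intro exI[of _ "(c + d, g) # ps"]) (auto simp: normal_def p simp del: linear_combination_simps)
    qed
  next
    case 2
    then have "\<And>q. q \<in> set ps \<Longrightarrow> germ_succ f (snd q)"
      using gs germ_succ_trans eventually_nonzero[OF g(1)] by blast
    with 2 Cons.prems assms show ?thesis
      by (intro exI[of _ "(c, f) # p # ps"]) (auto simp: normal_def p germ_eq_def)
  next
    case 3
    obtain qs where qs: "normal qs" "snd ` set qs \<subseteq> insert f (snd ` set ps)"
      "germ_eq (linear_combination qs) (\<lambda>x. c * f x + linear_combination ps x)"
      using Cons.IH norm by blast
    have "germ_succ g (snd q)" if "q \<in> set qs" for q
    proof -
      have "snd q \<in> insert f (snd ` set ps)" using that qs(2) by blast
      then show ?thesis using 3 gs by auto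
    qed
    then have "normal (p # qs)"
      using qs(1) g by (auto simp: normal_def p)
    moreover have "germ_eq (linear_combination (p # qs)) (\<lambda>x. c * f x + linear_combination (p # ps) x)"
      using qs(3) unfolding germ_eq_def p by eventually_elim simp
    ultimately show ?thesis using qs(2)
      by (intro exI[of _ "p # qs"]) auto
  qed
qed

lemma normal_form:
  assumes "snd ` set ps \<subseteq> S"
  shows "\<exists>qs. normal qs \<and> germ_eq (linear_combination qs) (linear_combination ps)"
  using assms
proof (induction ps)
  case Nil
  then show ?case by (intro exI[of _ "[]"]) (auto simp: normal_def germ_eq_def)
next
  case (Cons p ps)
  obtain c f where p: "p = (c, f)" by force
  obtain qs where qs: "normal qs" "germ_eq (linear_combination qs) (linear_combination ps)"
    using Cons by auto
  show ?case
  proof (cases "c = 0")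
    case True
    with qs show ?thesis by (intro exI[of _ qs]) (auto simp: p germ_eq_def)
  next
    case False
    obtain rs where "normal rs"
      and rs: "germ_eq (linear_combination rs) (\<lambda>x. c * f x + linear_combination qs x)"
      using normal_insert[OF qs(1) _ False, of f] Cons.prems p by auto
    moreover have "germ_eq (linear_combination rs) (linear_combination (p # ps))"
      using rs qs(2) unfolding germ_eq_def p by eventually_elim simp
    ultimately show ?thesis by blast
  qed
qed

lemma lower_terms_negligible:
  assumes "\<And>q. q \<in> set ps \<Longrightarrow> germ_succ g (snd q)"
  shows "((\<lambda>x. linear_combination ps x / g x) \<longlongrightarrow> 0) at_top"
  using assms
proof (induction ps)
  case (Cons p ps)
  obtain c f where p: "p = (c, f)" by force
  have "germ_succ g f" using Cons.prems p by force
  moreover have "((\<lambda>x. linear_combination ps x / g x) \<longlongrightarrow> 0) at_top" using Cons by simp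
  ultimately have "((\<lambda>x. c * (f x / g x) + linear_combination ps x / g x) \<longlongrightarrow> c * 0 + 0) at_top"
    by (intro tendsto_intros) (auto simp: germ_succ_def)
  then show ?case by (simp add: p add_divide_distrib)
qed simp

text \<open>A nonempty normal form equals its leading germ \<open>f\<close> times a factor tending
  to the leading coefficient \<open>c\<close>. As \<open>f\<close> tends to infinity, the sign of
  \<open>c\<close> decides between the two infinite limits; an empty normal form gives the zero
  germ.\<close>

lemma linear_combination_trichotomy:
  assumes "snd ` set ps \<subseteq> S"
  obtains "germ_eq (linear_combination ps) (\<lambda>_. 0)"
  | "filterlim (linear_combination ps) at_top at_top"
  | "filterlim (linear_combination ps) at_bot at_top"
proof -
  obtain qs where qs: "normal qs" "germ_eq (linear_combination qs) (linear_combination ps)"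
    using normal_form[OF assms] by blast
  show ?thesis
  proof (cases qs)
    case Nil
    with qs(2) have "germ_eq (linear_combination ps) (\<lambda>_. 0)"
      by (auto simp: germ_eq_def elim: eventually_mono)
    then show ?thesis by (rule that(1))
  next
    case (Cons q rs)
    obtain c f where q: "q = (c, f)" by force
    have f: "f \<in> S" and c: "c \<noteq> 0" and fs: "\<And>q. q \<in> set rs \<Longrightarrow> germ_succ f (snd q)"
      using qs(1) Cons q by (auto simp: normal_def)
    have "((\<lambda>x. c + linear_combination rs x / f x) \<longlongrightarrow> c + 0) at_top"
      using lower_terms_negligible[OF fs] by (intro tendsto_intros)
    moreover have "\<forall>\<^sub>F x in at_top. (c + linear_combination rs x / f x) * f x = linear_combination ps x"
      using qs(2) eventually_nonzero[OF f] unfolding germ_eq_def Cons q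
      by eventually_elim (simp add: field_simps)
    ultimately have *: "filterlim (linear_combination ps) F at_top"
      if "filterlim (\<lambda>x. (c + linear_combination rs x / f x) * f x) F at_top" for F
      using that filterlim_cong[OF refl refl] by fast
    have lim: "((\<lambda>x. c + linear_combination rs x / f x) \<longlongrightarrow> c) at_top"
      using \<open>(_ \<longlongrightarrow> c + 0) at_top\<close> by simp
    show ?thesis
    proof (cases "c > 0")
      case True
      then show ?thesis
        using that(2) * filterlim_tendsto_pos_mult_at_top[OF lim True unbounded[OF f]] by blast
    next
      case False
      with c have "c < 0" by simp
      then show ?thesis
        using that(3) * filterlim_tendsto_neg_mult_at_bot[OF lim _ unbounded[OF f]] by blast
    qed
  qed
qed

text \<open>The quotient \<open>f / g\<close> is the exponential of a difference of two
  combinations, again a combination over \<open>S\<close>. Its three possible behaviours are the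
  three cases of comparability.\<close>

lemma comparable_exp:
  assumes "snd ` set ps \<subseteq> S" "snd ` set qs \<subseteq> S"
    and "germ_eq f (\<lambda>x. exp (linear_combination ps x))"
    and "germ_eq g (\<lambda>x. exp (linear_combination qs x))"
  shows "comparable f g"
proof -
  define rs where "rs = ps @ map (\<lambda>(c, f). (- 1 * c, f)) qs"
  have rs: "linear_combination rs x = linear_combination ps x - linear_combination qs x" for x
    unfolding rs_def linear_combination_simps linear_combination_map_scale by simp
  have "snd ` set rs \<subseteq> S" using assms(1,2) by (auto simp: rs_def)
  then show ?thesis
  proof (cases rule: linear_combination_trichotomy)
    case 1
    then have "germ_eq f g"
      using assms(3,4) unfolding germ_eq_def by eventually_elim (simp add: rs)
    then show ?thesis by (simp add: comparable_def)
  next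
    case 2
    have "((\<lambda>x. exp (- linear_combination rs x)) \<longlongrightarrow> 0) at_top"
      using 2 by (intro filterlim_compose[OF exp_at_bot]) (simp add: filterlim_uminus_at_bot)
    moreover have "\<forall>\<^sub>F x in at_top. exp (- linear_combination rs x) = g x / f x"
      using assms(3,4) unfolding germ_eq_def by eventually_elim (simp add: rs exp_diff)
    ultimately have "germ_succ f g"
      unfolding germ_succ_def by (rule Lim_transform_eventually)
    then show ?thesis by (simp add: comparable_def)
  next
    case 3
    have "((\<lambda>x. exp (linear_combination rs x)) \<longlongrightarrow> 0) at_top"
      using 3 by (intro filterlim_compose[OF exp_at_bot])
    moreover have "\<forall>\<^sub>F x in at_top. exp (linear_combination rs x) = f x / g x"
      using assms(3,4) unfolding germ_eq_def by eventually_elim (simp add: rs exp_diff)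
    ultimately have "germ_succ g f"
      unfolding germ_succ_def by (rule Lim_transform_eventually)
    then show ?thesis by (simp add: comparable_def)
  qed
qed

end

section \<open>The scale of iterated logarithms\<close>

lemma filterlim_iter_ln: "filterlim (iter_ln j :: real \<Rightarrow> real) at_top at_top"
proof (induction j)
  case 0
  show ?case by (simp add: iter_ln_def filterlim_ident id_def)
next
  case (Suc j)
  have "iter_ln (Suc j) = (\<lambda>x::real. ln (iter_ln j x))" by (simp add: iter_ln_def fun_eq_iff)
  with Suc show ?case by (simp add: filterlim_compose[OF ln_at_top])
qed

lemma eventually_iter_ln_pos: "\<forall>\<^sub>F x::real in at_top. iter_ln j x > 0"
  using filterlim_iter_ln[of j] filterlim_at_top_dense[of "iter_ln j" at_top] by blast

lemma iter_ln_0 [simp]: "iter_ln 0 x = x"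
  by (simp add: iter_ln_def)

lemma iter_ln_Suc: "iter_ln (Suc j) x = ln (iter_ln j x)"
  by (simp add: iter_ln_def)

lemma germ_succ_iter_ln_Suc: "germ_succ (iter_ln i) (iter_ln (Suc i))"
proof -
  have "((\<lambda>x::real. ln x / x) \<longlongrightarrow> 0) at_top" by real_asymp
  from filterlim_compose[OF this filterlim_iter_ln[of i]]
  show ?thesis by (simp add: germ_succ_def iter_ln_Suc)
qed

lemma germ_succ_iter_ln: "i < j \<Longrightarrow> germ_succ (iter_ln i) (iter_ln j)"
proof (induction rule: strict_inc_induct)
  case (base i)
  then show ?case using germ_succ_iter_ln_Suc by simp
next
  case (step i)
  have "\<forall>\<^sub>F x::real in at_top. iter_ln (Suc i) x \<noteq> 0"
    using eventually_iter_ln_pos[of "Suc i"] by (auto elim: eventually_mono)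
  with step germ_succ_iter_ln_Suc show ?case
    using germ_succ_trans by blast
qed

interpretation iter_ln: growth_scale "range iter_ln"
proof
  fix f g :: "real \<Rightarrow> real"
  assume "f \<in> range iter_ln"
  then show "filterlim f at_top at_top" using filterlim_iter_ln by auto
  assume "g \<in> range iter_ln"
  with \<open>f \<in> range iter_ln\<close> obtain i j where "f = iter_ln i" "g = iter_ln j" by auto
  then show "comparable f g"
    using germ_succ_iter_ln[of i j] germ_succ_iter_ln[of j i]
    by (cases i j rule: linorder_cases) (auto simp: comparable_def germ_eq_def)
qed

section \<open>Log-exp germs are comparable\<close>

text \<open>The formal logarithm of a reduced expression. The index shift arises because the
  logarithm of the power of \<open>iter_ln j\<close> is a multiple of
  \<open>iter_ln (Suc j)\<close>.\<close>

fun log_terms :: "logexp \<Rightarrow> (real \<times> (real \<Rightarrow> real)) list" where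
  "log_terms (LogExp \<Phi> \<alpha>) =
     map (\<lambda>(c, M). (c, eval M)) \<Phi> @ map (\<lambda>j. (\<alpha> ! j, iter_ln (Suc j))) [0..<length \<alpha>]"

lemma eval_eq_exp: "germ_eq (eval L) (\<lambda>x. exp (linear_combination (log_terms L) x))"
proof (cases L)
  case (LogExp \<Phi> \<alpha>)
  have "\<forall>\<^sub>F x::real in at_top. \<forall>j\<in>{..<length \<alpha>}. iter_ln j x > 0"
    using eventually_iter_ln_pos by (simp add: eventually_ball_finite)
  then show ?thesis
    unfolding germ_eq_def
  proof eventually_elim
    case (elim x)
    have "iter_ln j x powr \<alpha> ! j = exp (\<alpha> ! j * iter_ln (Suc j) x)" if "j < length \<alpha>" for j
    proof -
      have "iter_ln j x > 0" using elim that by auto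
      then show ?thesis by (simp add: powr_def iter_ln_Suc)
    qed
    then have "(\<Prod>j<length \<alpha>. iter_ln j x powr \<alpha> ! j) = exp (\<Sum>j<length \<alpha>. \<alpha> ! j * iter_ln (Suc j) x)"
      by (simp add: exp_sum)
    also have "(\<Sum>j<length \<alpha>. \<alpha> ! j * iter_ln (Suc j) x) =
      linear_combination (map (\<lambda>j. (\<alpha> ! j, iter_ln (Suc j))) [0..<length \<alpha>]) x"
      by (simp add: linear_combination_def o_def interv_sum_list_conv_sum_set_nat atLeast0LessThan)
    finally have *: "(\<Prod>j<length \<alpha>. iter_ln j x powr \<alpha> ! j) =
      exp (linear_combination (map (\<lambda>j. (\<alpha> ! j, iter_ln (Suc j))) [0..<length \<alpha>]) x)" .
    have "linear_combination (map (\<lambda>(c, M). (c, eval M)) \<Phi>) x = (\<Sum>(c, M)\<leftarrow>\<Phi>. c * eval M x)"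
      by (induction \<Phi>) auto
    with * show ?case by (simp add: LogExp exp_add)
  qed
qed

lemma eventually_eval_pos: "\<forall>\<^sub>F x::real in at_top. eval L x > 0"
  using eval_eq_exp[of L] unfolding germ_eq_def by eventually_elim simp

lemma logexp_le_mono: "i \<le> j \<Longrightarrow> logexp_le i \<subseteq> logexp_le j"
  by (rule lift_Suc_mono_le) auto

lemma monomial_in_logexp_le: "LogExp [] \<alpha> \<in> logexp_le h"
  using logexp_le_mono[of 0 h] by auto

text \<open>The exponent list is a unit vector. This turns an iterated logarithm into an expression
  of level 0, so that induction hypotheses about expressions apply to it. Positivity of the earlier
  iterates is required because \<open>0 powr 0\<close> is 0.\<close>

lemma iter_ln_eq_eval: "germ_eq (iter_ln j) (eval (LogExp [] (replicate j 0 @ [1])))"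
proof -
  have "\<forall>\<^sub>F x::real in at_top. \<forall>i\<in>{..j}. iter_ln i x > 0"
    using eventually_iter_ln_pos by (simp add: eventually_ball_finite)
  then show ?thesis
    unfolding germ_eq_def
  proof eventually_elim
    case (elim x)
    have "(\<Prod>i<j. iter_ln i x powr ((replicate j 0 @ [1]) ! i)) = (\<Prod>i<j. 1)"
    proof (intro prod.cong)
      fix i assume "i \<in> {..<j}"
      with elim have "iter_ln i x > 0" by auto
      with \<open>i \<in> {..<j}\<close> show "iter_ln i x powr ((replicate j 0 @ [1]) ! i) = 1"
        by (simp add: nth_append)
    qed simp
    moreover have "iter_ln j x > 0" using elim by auto
    ultimately show ?case by (simp add: nth_append)
  qed
qed

lemma comparable_cong:
  assumes "germ_eq f f'" "germ_eq g g'"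
  shows "comparable f g \<longleftrightarrow> comparable f' g'"
proof -
  have ev: "\<forall>\<^sub>F x in at_top. f x = f' x \<and> g x = g' x"
    using assms by (simp add: germ_eq_def eventually_conj_iff)
  have "germ_eq f g \<longleftrightarrow> germ_eq f' g'"
    unfolding germ_eq_def
    by (rule eventually_subst) (rule eventually_mono[OF ev], simp)
  moreover have "germ_succ f g \<longleftrightarrow> germ_succ f' g'"
    unfolding germ_succ_def
    by (rule filterlim_cong[OF refl refl]) (rule eventually_mono[OF ev], simp)
  moreover have "germ_succ g f \<longleftrightarrow> germ_succ g' f'"
    unfolding germ_succ_def
    by (rule filterlim_cong[OF refl refl]) (rule eventually_mono[OF ev], simp)
  ultimately show ?thesis by (simp add: comparable_def)
qed

lemma log_terms_logexp_le_0:
  "L \<in> logexp_le 0 \<Longrightarrow> snd ` set (log_terms L) \<subseteq> range iter_ln"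
  by auto

text \<open>Levels are cumulative, so the induction only has to descend until the expression is a
  newly formed one; the exponent is then reduced over the level below, which gives both membership
  and divergence of its germs.\<close>

lemma log_terms_logexp_le_Suc:
  assumes "L \<in> logexp_le (Suc h)"
  shows "snd ` set (log_terms L) \<subseteq>
    {eval M |M. M \<in> logexp_le h \<and> filterlim (eval M :: real \<Rightarrow> real) at_top at_top} \<union> range iter_ln"
  using assms
proof (induction h)
  case 0
  have "eval M \<in> {eval M |M. M \<in> logexp_le 0 \<and> filterlim (eval M :: real \<Rightarrow> real) at_top at_top}"
    if "reduced_exponent (logexp_le 0) \<Phi>" "(c, M) \<in> set \<Phi>" for c M \<Phi>
    using that unfolding reduced_exponent_def by blast
  with 0 show ?case by fastforce
next
  case (Suc h)
  then consider "L \<in> logexp_le (Suc h)"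
    | \<Phi> \<alpha> where "L = LogExp \<Phi> \<alpha>" "reduced_exponent (logexp_le (Suc h)) \<Phi>"
    by (subst (asm) logexp_le.simps(2)) blast
  then show ?case
  proof cases
    case 1
    with Suc.IH show ?thesis by (auto simp: subset_iff)
  next
    case 2
    have "eval M \<in> {eval M |M. M \<in> logexp_le (Suc h) \<and> filterlim (eval M :: real \<Rightarrow> real) at_top at_top}"
      if "(c, M) \<in> set \<Phi>" for c M
      using that 2(2) unfolding reduced_exponent_def by blast
    then show ?thesis by (fastforce simp: 2(1) simp del: logexp_le.simps)
  qed
qed

text \<open>Logarithms at level \<open>Suc h\<close> are combinations of unbounded germs of level
  \<open>h\<close> and of iterated logarithms. By the induction hypothesis these form a growth
  scale, and \<open>comparable_exp\<close> lifts comparability through the exponential.\<close>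

lemma comparable_logexp_le:
  "L \<in> logexp_le h \<Longrightarrow> L' \<in> logexp_le h \<Longrightarrow> comparable (eval L) (eval L')"
proof (induction h arbitrary: L L')
  case 0
  show ?case
    by (rule iter_ln.comparable_exp[OF log_terms_logexp_le_0 log_terms_logexp_le_0 eval_eq_exp eval_eq_exp])
      (use 0 in auto)
next
  case (Suc h)
  define S :: "(real \<Rightarrow> real) set" where "S = {eval M |M. M \<in> logexp_le h \<and> filterlim (eval M :: real \<Rightarrow> real) at_top at_top} \<union>
    range iter_ln"
  \<comment> \<open>Every germ in \<open>S\<close> has a representative expression of level
    \<open>h\<close>, which brings all pairs in \<open>S\<close>, mixed ones included, under the
    induction hypothesis.\<close>
  have repr: "\<exists>M\<in>logexp_le h. germ_eq f (eval M)" if "f \<in> S" for f :: "real \<Rightarrow> real"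
  proof (cases "f \<in> range iter_ln")
    case True
    then show ?thesis using iter_ln_eq_eval monomial_in_logexp_le by blast
  next
    case False
    with that obtain M where "M \<in> logexp_le h" "f = eval M" by (auto simp: S_def)
    then show ?thesis by (intro bexI[of _ M]) (auto simp: germ_eq_def)
  qed
  interpret growth_scale S
  proof
    fix f assume f: "f \<in> S"
    then show "filterlim f at_top at_top" using filterlim_iter_ln by (auto simp: S_def)
    fix g assume g: "g \<in> S"
    obtain M where "M \<in> logexp_le h" "germ_eq f (eval M)" using repr f by blast
    moreover obtain M' where "M' \<in> logexp_le h" "germ_eq g (eval M')" using repr g by blast
    ultimately show "comparable f g" using Suc.IH comparable_cong by blast
  qed
  show ?case
    by (rule comparable_exp[OF _ _ eval_eq_exp eval_eq_exp])
      (use Suc.prems log_terms_logexp_le_Suc in \<open>unfold S_def, blast+\<close>)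
qed

lemma comparable_logexp_germs:
  assumes "L \<in> logexp_germs" "L' \<in> logexp_germs"
  shows "comparable (eval L) (eval L')"
proof -
  obtain i j where "L \<in> logexp_le i" "L' \<in> logexp_le j"
    using assms by (auto simp: logexp_germs_def)
  then show ?thesis
    using logexp_le_mono[of i "max i j"] logexp_le_mono[of j "max i j"]
    by (intro comparable_logexp_le[of _ "max i j"]) auto
qed

section \<open>The Gaussian monomial\<close>

definition gaussian :: logexp where
  "gaussian = LogExp [(1 / 2, LogExp [] [2])] []"

lemma real_powr_2: "x powr 2 = x\<^sup>2" for x :: real
  using powr_numeral[of x] powr_numeral[of "- x"] uminus_powr_eq[of x 2] by (cases "x \<ge> 0") auto

lemma eval_gaussian_real: "eval gaussian x = exp (x\<^sup>2 / 2)" for x :: real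
  by (simp add: gaussian_def real_powr_2)

text \<open>The exponent is reduced because the square is no iterated logarithm of index at least 1:
  equality with \<open>iter_ln j\<close> would make \<open>iter_ln j x / x\<close> equal to
  \<open>x\<close>, although this ratio tends to 0.\<close>

lemma gaussian_in_logexp_germs: "gaussian \<in> logexp_germs"
proof -
  have sq: "eval (LogExp [] [2]) = (\<lambda>x::real. x\<^sup>2)"
    by (simp add: fun_eq_iff real_powr_2)
  have "\<not> germ_eq (eval (LogExp [] [2]) :: real \<Rightarrow> real) (iter_ln j)" if "j \<ge> 1" for j
  proof
    assume "germ_eq (eval (LogExp [] [2]) :: real \<Rightarrow> real) (iter_ln j)"
    then have ev: "\<forall>\<^sub>F x::real in at_top. iter_ln j x / x = x"
      unfolding germ_eq_def sq using eventually_gt_at_top[of 0]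
      by eventually_elim (simp add: power2_eq_square divide_eq_eq)
    have "((\<lambda>x::real. iter_ln j x / x) \<longlongrightarrow> 0) at_top"
      using germ_succ_iter_ln[of 0 j] that by (simp add: germ_succ_def)
    then have "((\<lambda>x::real. x) \<longlongrightarrow> 0) at_top"
      using ev by (rule Lim_transform_eventually)
    then show False
      using not_tendsto_and_filterlim_at_infinity[of at_top "\<lambda>x::real. x" 0]
        filterlim_at_top_imp_at_infinity[OF filterlim_ident] by simp
  qed
  moreover have "filterlim (\<lambda>x::real. x\<^sup>2) at_top at_top"
    by real_asymp
  ultimately have "reduced_exponent (logexp_le 0) [(1 / 2, LogExp [] [2])]"
    by (auto simp: reduced_exponent_def sq simp del: eval.simps)
  then have "gaussian \<in> logexp_le 1"
    by (auto simp: gaussian_def)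
  then show ?thesis unfolding logexp_germs_def by blast
qed

section \<open>Domination of gamma-type germs by the Gaussian\<close>

text \<open>A crude substitute for Stirling's formula: compactness bounds Gamma on the interval from
  1 to 2, and the functional equation extends the bound by one unit per induction step.\<close>

lemma Gamma_le_powr: "\<exists>B>0. \<forall>x\<ge>1. Gamma x \<le> B * x powr (x::real)"
proof -
  have "continuous_on {1..2} (Gamma :: real \<Rightarrow> real)"
    by (intro continuous_on_Gamma continuous_on_id) (auto elim!: nonpos_Ints_cases)
  then obtain B where B: "\<And>x. x \<in> {1..2} \<Longrightarrow> Gamma x \<le> (B::real)"
    using continuous_attains_sup[of "{1..2}" "Gamma :: real \<Rightarrow> real"] by force
  have "B > 0"
    using B[of 1] by simp
  have "Gamma x \<le> B * x powr x" if "1 \<le> x" "x \<le> 2 + real n" for n x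
    using that
  proof (induction n arbitrary: x)
    case 0
    have "B * 1 \<le> B * x powr x"
      using 0 \<open>B > 0\<close> ge_one_powr_ge_zero[of x x] by (intro mult_left_mono) auto
    with B[of x] 0 show ?case by simp
  next
    case (Suc n)
    show ?case
    proof (cases "x \<le> 2")
      case True
      have "B * 1 \<le> B * x powr x"
        using Suc.prems \<open>B > 0\<close> ge_one_powr_ge_zero[of x x] by (intro mult_left_mono) auto
      with B[of x] True Suc.prems show ?thesis by simp
    next
      case False
      have "Gamma (x - 1) \<le> B * (x - 1) powr (x - 1)"
        using False Suc.prems by (intro Suc.IH) auto
      also have "\<dots> \<le> B * x powr (x - 1)"
        using False \<open>B > 0\<close> by (intro mult_left_mono powr_mono2) auto
      finally have *: "Gamma (x - 1) \<le> B * x powr (x - 1)" .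
      have "Gamma x = (x - 1) * Gamma (x - 1)"
        using Gamma_plus1[of "x - 1"] False nonpos_Ints_nonpos[of "x - 1"] by auto
      also have "\<dots> \<le> x * (B * x powr (x - 1))"
        using * False by (intro mult_mono) auto
      also have "\<dots> = B * x powr x"
        using False by (simp add: powr_diff)
      finally show ?thesis .
    qed
  qed
  moreover have "\<exists>n. x \<le> 2 + real n" for x
    using real_arch_simple[of "x - 2"] by (auto simp: algebra_simps)
  ultimately show ?thesis
    using \<open>B > 0\<close> by blast
qed

lemma eventually_growth_eval_pos:
  assumes "growth_monomial M"
  shows "\<forall>\<^sub>F x::real in at_top. growth_eval M x > 0"
proof (cases M)
  case (Pure L)
  then show ?thesis using eventually_eval_pos[of L] by simp
next
  case (Gamma_Type \<theta> H \<kappa>)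
  show ?thesis
    using eventually_eval_pos[of H] eventually_ge_at_top[of 0]
  proof eventually_elim
    case (elim x)
    then have "\<kappa> * x + 1 > 0" using assms Gamma_Type by (simp add: add_nonneg_pos)
    with elim show ?case by (simp add: Gamma_Type)
  qed
qed

text \<open>The logarithm of a gamma-type germ grows at most like \<open>x * ln x\<close> up to a
  constant factor, which loses against the quadratic exponent.\<close>

lemma germ_succ_gaussian_gamma_type:
  assumes "H \<in> logexp_subexp" "\<kappa> > 0"
  shows "germ_succ (eval gaussian) (growth_eval (Gamma_Type \<theta> H \<kappa>))"
proof -
  obtain B where B: "B > 0" "\<And>x. x \<ge> 1 \<Longrightarrow> Gamma x \<le> B * x powr (x::real)"
    using Gamma_le_powr by blast
  \<comment> \<open>The factor \<open>exp x\<close> absorbs \<open>eval H x\<close>, whose logarithm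
    is o(x) and hence eventually at most \<open>x\<close>.\<close>
  define bound where
    "bound x = exp (\<theta> * x) * exp x * (B * (\<kappa> * x + 1) powr (\<kappa> * x + 1)) / exp (x\<^sup>2 / 2)" for x
  have "((\<lambda>x. B * exp ((\<theta> + 1) * x + (\<kappa> * x + 1) * ln (\<kappa> * x + 1) - x\<^sup>2 / 2)) \<longlongrightarrow> B * 0) at_top"
  proof (intro tendsto_mult tendsto_const filterlim_compose[OF exp_at_bot])
    show "filterlim (\<lambda>x. (\<theta> + 1) * x + (\<kappa> * x + 1) * ln (\<kappa> * x + 1) - x\<^sup>2 / 2) at_bot at_top"
      using \<open>\<kappa> > 0\<close> by real_asymp
  qed
  moreover have "\<forall>\<^sub>F x in at_top. B * exp ((\<theta> + 1) * x + (\<kappa> * x + 1) * ln (\<kappa> * x + 1) - x\<^sup>2 / 2) = bound x"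
    using eventually_ge_at_top[of 0]
  proof eventually_elim
    case (elim x)
    then have "\<kappa> * x + 1 > 0" using \<open>\<kappa> > 0\<close> by (simp add: add_nonneg_pos)
    then show ?case by (simp add: bound_def powr_def exp_add exp_diff algebra_simps)
  qed
  ultimately have "(bound \<longlongrightarrow> B * 0) at_top"
    by (rule Lim_transform_eventually)
  then have "(bound \<longlongrightarrow> 0) at_top" by simp
  moreover have "\<forall>\<^sub>F x in at_top. norm (growth_eval (Gamma_Type \<theta> H \<kappa>) x / eval gaussian x) \<le> bound x"
  proof -
    have "(\<lambda>x::real. ln (eval H x)) \<in> o[at_top](\<lambda>x. x)"
      using assms by (simp add: logexp_subexp_def)
    from landau_o.smallD[OF this, of 1]
    have "\<forall>\<^sub>F x::real in at_top. \<bar>ln (eval H x)\<bar> \<le> \<bar>x\<bar>" by simp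
    then show ?thesis
      using eventually_eval_pos[of H] eventually_ge_at_top[of 0]
    proof eventually_elim
      case (elim x)
      have "\<kappa> * x \<ge> 0" using elim \<open>\<kappa> > 0\<close> by simp
      moreover have "eval H x \<le> exp x"
        using elim exp_le_cancel_iff[of "ln (eval H x)" x] by simp
      ultimately have "exp (\<theta> * x) * eval H x * Gamma (\<kappa> * x + 1) \<le>
          exp (\<theta> * x) * exp x * (B * (\<kappa> * x + 1) powr (\<kappa> * x + 1))"
        using elim B by (intro mult_mono) auto
      with elim \<open>\<kappa> * x \<ge> 0\<close> show ?case
        by (simp add: bound_def eval_gaussian_real divide_right_mono abs_mult)
    qed
  qed
  ultimately show ?thesis
    unfolding germ_succ_def by (rule Lim_null_comparison[rotated])
qed

text \<open>Resonance would send the quotient to some \<open>C > 0\<close> while its reciprocal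
  tends to 0, yet their product is eventually 1.\<close>

lemma gaussian_not_gamma_resonant: "\<not> gamma_resonant gaussian"
proof
  assume "gamma_resonant gaussian"
  then obtain \<theta> H \<kappa> C where H: "H \<in> logexp_subexp" "\<kappa> > 0" and "C > 0"
    and lim: "((\<lambda>x::real. eval gaussian x / growth_eval (Gamma_Type \<theta> H \<kappa>) x) \<longlongrightarrow> C) at_top"
    unfolding gamma_resonant_def by auto
  let ?g = "growth_eval (Gamma_Type \<theta> H \<kappa>) :: real \<Rightarrow> real"
  have "((\<lambda>x. (eval gaussian x / ?g x) * (?g x / eval gaussian x)) \<longlongrightarrow> C * 0) at_top"
    using lim germ_succ_gaussian_gamma_type[OF H] unfolding germ_succ_def by (rule tendsto_mult)
  moreover have "\<forall>\<^sub>F x in at_top. (eval gaussian x / ?g x) * (?g x / eval gaussian x) = 1"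
    using eventually_growth_eval_pos[of "Gamma_Type \<theta> H \<kappa>"] H
    by (auto simp: eval_gaussian_real simp del: growth_eval.simps elim: eventually_mono)
  ultimately have "((\<lambda>x::real. 1::real) \<longlongrightarrow> C * 0) at_top"
    by (rule Lim_transform_eventually)
  then show False by (simp add: tendsto_const_iff)
qed

lemma growth_monomial_gaussian: "growth_monomial (Pure gaussian)"
  by (simp add: gaussian_in_logexp_germs gaussian_not_gamma_resonant)

lemma growth_monomial_gaussian_cases:
  assumes "growth_monomial M"
  obtains L where "M = Pure L" "germ_eq (eval L) (\<lambda>x. exp (x\<^sup>2 / 2))"
  | "germ_succ (growth_eval M) (\<lambda>x. exp (x\<^sup>2 / 2))"
  | "germ_succ (\<lambda>x. exp (x\<^sup>2 / 2)) (growth_eval M)"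
proof (cases M)
  case (Pure L)
  then have "comparable (eval L) (eval gaussian)"
    using assms gaussian_in_logexp_germs by (intro comparable_logexp_germs) auto
  moreover have "eval gaussian = (\<lambda>x::real. exp (x\<^sup>2 / 2))"
    using eval_gaussian_real by blast
  moreover have "growth_eval M = (eval L :: real \<Rightarrow> real)"
    using Pure by (simp add: fun_eq_iff)
  ultimately show ?thesis
    using that Pure unfolding comparable_def by metis
next
  case (Gamma_Type \<theta> H \<kappa>)
  have "eval gaussian = (\<lambda>x::real. exp (x\<^sup>2 / 2))"
    using eval_gaussian_real by blast
  then show ?thesis
    using that(3) germ_succ_gaussian_gamma_type[of H \<kappa> \<theta>] assms Gamma_Type by simp
qed

section \<open>Uniqueness of the interpolating element\<close>

lemma exp_i_pi_nat: "exp (\<i> * complex_of_real pi * of_nat n) = (-1) ^ n"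
  using exp_of_nat_mult[of n "\<i> * pi"] by (simp add: mult_ac)

lemma osc_germ_Cons:
  "osc_germ ((A, B, M) # c) (real n) = (A + (-1) ^ n * B) * of_real (growth_eval M (real n)) + osc_germ c (real n)"
  by (simp add: osc_germ_def exp_i_pi_nat mult.commute[of B])

lemma osc_sums_Cons:
  assumes "(A, B, M) # c \<in> osc_sums"
  shows "growth_monomial M" "(A, B) \<noteq> (0, 0)" "c \<in> osc_sums"
    and "(A', B', M') \<in> set c \<Longrightarrow> germ_succ (growth_eval M) (growth_eval M')"
  using assms by (auto simp: osc_sums_def growth_chain_def)

lemma osc_germ_negligible:
  assumes "\<And>A B M. (A, B, M) \<in> set c \<Longrightarrow> germ_succ g (growth_eval M)"
  shows "(\<lambda>n. osc_germ c (real n) / of_real (g (real n))) \<longlonglongrightarrow> 0"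
  using assms
proof (induction c)
  case Nil
  then show ?case by (simp add: osc_germ_def)
next
  case (Cons p c)
  obtain A B M where p: "p = (A, B, M)" by (cases p) auto
  have "(\<lambda>n. growth_eval M (real n) / g (real n)) \<longlonglongrightarrow> 0"
    using Cons.prems[of A B M] p filterlim_compose[OF _ filterlim_real_sequentially]
    by (auto simp: germ_succ_def)
  then have "(\<lambda>n. complex_of_real (growth_eval M (real n) / g (real n))) \<longlonglongrightarrow> of_real 0"
    by (rule tendsto_of_real)
  then have M: "(\<lambda>n. complex_of_real (growth_eval M (real n) / g (real n))) \<longlonglongrightarrow> 0" by simp
  have "(\<lambda>n. (A + (-1) ^ n * B) * complex_of_real (growth_eval M (real n) / g (real n))) \<longlonglongrightarrow> 0"
  proof (rule Lim_null_comparison)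
    show "\<forall>\<^sub>F n in sequentially. norm ((A + (-1) ^ n * B) * complex_of_real (growth_eval M (real n) / g (real n)))
        \<le> (norm A + norm B) * norm (complex_of_real (growth_eval M (real n) / g (real n)))"
    proof (intro always_eventually allI)
      fix n
      have "norm (A + (-1) ^ n * B) \<le> norm A + norm B"
        using norm_triangle_ineq[of A "(-1) ^ n * B"] by (simp add: norm_mult norm_power)
      then show "norm ((A + (-1) ^ n * B) * complex_of_real (growth_eval M (real n) / g (real n)))
        \<le> (norm A + norm B) * norm (complex_of_real (growth_eval M (real n) / g (real n)))"
        unfolding norm_mult by (rule mult_right_mono) simp
    qed
    show "(\<lambda>n. (norm A + norm B) * norm (complex_of_real (growth_eval M (real n) / g (real n)))) \<longlonglongrightarrow> 0"
      using tendsto_mult_right_zero[OF tendsto_norm_zero[OF M]] by simp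
  qed
  moreover have "(\<lambda>n. osc_germ c (real n) / of_real (g (real n))) \<longlonglongrightarrow> 0"
    using Cons by auto
  ultimately have "(\<lambda>n. (A + (-1) ^ n * B) * complex_of_real (growth_eval M (real n) / g (real n)) +
      osc_germ c (real n) / of_real (g (real n))) \<longlonglongrightarrow> 0"
    using tendsto_add by fastforce
  then show ?case
    by (simp add: p osc_germ_Cons add_divide_distrib)
qed

text \<open>At the integers, division by the leading monomial leaves its bounded alternating
  coefficient plus the contribution of the dominated terms, which tends to 0.\<close>

lemma osc_germ_leading:
  assumes "(A, B, M) # c \<in> osc_sums"
  shows "(\<lambda>n. osc_germ ((A, B, M) # c) (real n) / of_real (growth_eval M (real n)) - (A + (-1) ^ n * B)) \<longlonglongrightarrow> 0"
proof -
  have "\<forall>\<^sub>F n in sequentially. growth_eval M (real n) > 0"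
    using eventually_growth_eval_pos[OF osc_sums_Cons(1)[OF assms]]
    by (rule eventually_compose_filterlim[OF _ filterlim_real_sequentially])
  then have "\<forall>\<^sub>F n in sequentially. osc_germ c (real n) / of_real (growth_eval M (real n)) =
     osc_germ ((A, B, M) # c) (real n) / of_real (growth_eval M (real n)) - (A + (-1) ^ n * B)"
    by eventually_elim (simp add: osc_germ_Cons add_divide_distrib)
  with osc_germ_negligible[OF osc_sums_Cons(4)[OF assms]] show ?thesis
    by (rule Lim_transform_eventually)
qed

text \<open>The even and odd subsequences are the constants \<open>A + B\<close> and
  \<open>A - B\<close>.\<close>

lemma alternating_tendsto_0:
  fixes A B :: complex
  assumes "(\<lambda>n. A + (-1) ^ n * B) \<longlonglongrightarrow> 0"
  shows "A = 0 \<and> B = 0"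
proof -
  have "(\<lambda>n. A + (-1) ^ (2 * n) * B) \<longlonglongrightarrow> 0" "(\<lambda>n. A + (-1) ^ (2 * n + 1) * B) \<longlonglongrightarrow> 0"
    using assms LIMSEQ_subseq_LIMSEQ[OF assms, of "\<lambda>n. 2 * n"]
      LIMSEQ_subseq_LIMSEQ[OF assms, of "\<lambda>n. 2 * n + 1"]
    by (auto simp: strict_mono_def o_def)
  then have "A + B = 0" "A - B = 0"
    by (simp_all add: LIMSEQ_const_iff)
  then show ?thesis by (simp add: add_eq_0_iff)
qed

lemma osc_germ_eventually_0:
  assumes "c \<in> osc_sums" "\<forall>\<^sub>F n in sequentially. osc_germ c (real n) = 0"
  shows "c = []"
proof (rule ccontr)
  assume "c \<noteq> []"
  then obtain A B M cs where c: "c = (A, B, M) # cs" by (metis neq_Nil_conv prod_cases3)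
  have "\<forall>\<^sub>F n in sequentially. - (osc_germ c (real n) / of_real (growth_eval M (real n)) - (A + (-1) ^ n * B)) =
      A + (-1) ^ n * B"
    using assms(2) by eventually_elim simp
  with tendsto_minus[OF osc_germ_leading[OF assms(1)[unfolded c], folded c], unfolded minus_zero]
  have "(\<lambda>n. A + (-1) ^ n * B) \<longlonglongrightarrow> 0"
    by (rule Lim_transform_eventually)
  then show False
    using alternating_tendsto_0 osc_sums_Cons(2)[of A B M cs] assms(1) c by auto
qed

text \<open>The leading monomial is compared with the Gaussian through their quotient
  \<open>q\<close>. If \<open>q\<close> tends to 0, both leading coefficients vanish; if
  \<open>1 / q\<close> tends to 0, a bounded coefficient cannot match \<open>q\<close>. Hence the
  germs agree, which forces the coefficients 0 and 1, and the remaining terms vanish at the large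
  integers.\<close>

lemma osc_germ_alternating_gaussian:
  assumes "c \<in> osc_sums"
    and eq: "\<forall>\<^sub>F n in sequentially. osc_germ c (real n) = (-1) ^ n * of_real (exp ((real n)\<^sup>2 / 2))"
  obtains L where "c = [(0, 1, Pure L)]" "growth_monomial (Pure L)" "germ_eq (eval L) (\<lambda>x. exp (x\<^sup>2 / 2))"
proof -
  have "c \<noteq> []"
  proof
    assume "c = []"
    with eq have "\<forall>\<^sub>F n::nat in sequentially. False" by (simp add: osc_germ_def)
    then show False by simp
  qed
  then obtain A B M cs where c: "c = (A, B, M) # cs" by (metis neq_Nil_conv prod_cases3)
  note cs = osc_sums_Cons[OF assms(1)[unfolded c]]
  have pos: "\<forall>\<^sub>F n in sequentially. growth_eval M (real n) > 0"
    using eventually_growth_eval_pos[OF cs(1)]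
    by (rule eventually_compose_filterlim[OF _ filterlim_real_sequentially])
  define q where "q n = exp ((real n)\<^sup>2 / 2) / growth_eval M (real n)" for n
  have "\<forall>\<^sub>F n in sequentially. osc_germ c (real n) / of_real (growth_eval M (real n)) - (A + (-1) ^ n * B) =
      (-1) ^ n * of_real (q n) - (A + (-1) ^ n * B)"
    using eq by eventually_elim (simp add: q_def)
  with osc_germ_leading[OF assms(1)[unfolded c], folded c]
  have lead: "(\<lambda>n. (-1) ^ n * of_real (q n) - (A + (-1) ^ n * B)) \<longlonglongrightarrow> 0"
    by (rule Lim_transform_eventually)
  from cs(1) show ?thesis
  proof (cases rule: growth_monomial_gaussian_cases)
    case (1 L)
    have "\<forall>\<^sub>F n in sequentially. growth_eval M (real n) = exp ((real n)\<^sup>2 / 2)"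
      using 1 eventually_compose_filterlim[OF _ filterlim_real_sequentially] by (auto simp: germ_eq_def)
    note M = this
    then have "\<forall>\<^sub>F n in sequentially. - ((-1) ^ n * of_real (q n) - (A + (-1) ^ n * B)) = A + (-1) ^ n * (B - 1)"
      by eventually_elim (simp add: q_def algebra_simps)
    with tendsto_minus[OF lead, unfolded minus_zero] have "(\<lambda>n. A + (-1) ^ n * (B - 1)) \<longlonglongrightarrow> 0"
      by (rule Lim_transform_eventually)
    from alternating_tendsto_0[OF this] have AB: "A = 0" "B = 1" by auto
    have "\<forall>\<^sub>F n in sequentially. osc_germ cs (real n) = 0"
      using eq M by eventually_elim (simp add: c osc_germ_Cons AB)
    with cs(3) have "cs = []" by (rule osc_germ_eventually_0)
    with AB c 1 cs(1) that show ?thesis by simp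
  next
    case 2
    then have "q \<longlonglongrightarrow> 0"
      unfolding q_def germ_succ_def by (rule filterlim_compose[OF _ filterlim_real_sequentially])
    then have "(\<lambda>n. norm ((-1) ^ n * complex_of_real (q n))) \<longlonglongrightarrow> 0"
      by (simp add: norm_mult norm_power tendsto_rabs_zero)
    then have "(\<lambda>n. (-1) ^ n * complex_of_real (q n)) \<longlonglongrightarrow> 0"
      by (simp only: tendsto_norm_zero_iff)
    from tendsto_diff[OF this lead] have "(\<lambda>n. A + (-1) ^ n * B) \<longlonglongrightarrow> 0" by simp
    with alternating_tendsto_0 cs(2) show ?thesis by blast
  next
    case 3
    then have "(\<lambda>n. growth_eval M (real n) / exp ((real n)\<^sup>2 / 2)) \<longlonglongrightarrow> 0"
      unfolding germ_succ_def by (rule filterlim_compose[OF _ filterlim_real_sequentially])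
    then have r: "(\<lambda>n. 1 / q n) \<longlonglongrightarrow> 0" by (simp add: q_def)
    \<comment> \<open>By the triangle inequality \<open>q n\<close> is at most the bracket, so the
      product with \<open>1 / q n\<close> is at least 1; but the bracket converges and
      \<open>1 / q n\<close> tends to 0.\<close>
    have "(\<lambda>n. (norm ((-1) ^ n * of_real (q n) - (A + (-1) ^ n * B)) + (norm A + norm B)) * (1 / q n)) \<longlonglongrightarrow>
        (norm (0::complex) + (norm A + norm B)) * 0"
      by (intro tendsto_intros lead r)
    then have "(\<lambda>n. (norm ((-1) ^ n * of_real (q n) - (A + (-1) ^ n * B)) + (norm A + norm B)) * (1 / q n)) \<longlonglongrightarrow> 0"
      by simp
    moreover have "\<forall>\<^sub>F n in sequentially. norm (1::real) \<le>
        (norm ((-1) ^ n * of_real (q n) - (A + (-1) ^ n * B)) + (norm A + norm B)) * (1 / q n)"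
      using pos
    proof eventually_elim
      case (elim n)
      then have "q n > 0" by (simp add: q_def)
      have "norm (A + (-1) ^ n * B) \<le> norm A + norm B"
        using norm_triangle_ineq[of A "(-1) ^ n * B"] by (simp add: norm_mult norm_power)
      moreover have "norm ((-1) ^ n * complex_of_real (q n)) = q n"
        using \<open>q n > 0\<close> by (simp add: norm_mult norm_power)
      ultimately have "q n \<le> norm ((-1) ^ n * of_real (q n) - (A + (-1) ^ n * B)) + (norm A + norm B)"
        using norm_triangle_sub[of "(-1) ^ n * complex_of_real (q n)" "A + (-1) ^ n * B"] by linarith
      with \<open>q n > 0\<close> show ?case by (simp add: field_simps)
    qed
    ultimately have "(\<lambda>n::nat. 1::real) \<longlonglongrightarrow> 0"
      by (rule Lim_null_comparison[rotated])
    then show ?thesis by (simp add: LIMSEQ_const_iff)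
  qed
qed

section \<open>Analytic continuation of log-exp germs\<close>

text \<open>The real part of the principal logarithm of w is \<open>ln (norm w)\<close>, which is at
  least the logarithm of the real part when that is positive. The bound \<open>K\<close> stays
  arbitrary because the induction step invokes the hypothesis at \<open>exp K\<close>.\<close>

lemma iter_ln_right_half_plane:
  "\<forall>\<^sub>F s in at_top. \<forall>z::complex. Re z > s \<longrightarrow> Re (iter_ln j z) > K"
proof (induction j arbitrary: K)
  case 0
  show ?case using eventually_ge_at_top[of K] by eventually_elim auto
next
  case (Suc j)
  from Suc[of "exp K"] show ?case
  proof eventually_elim
    case (elim s)
    show ?case
    proof (intro allI impI)
      fix z :: complex assume "Re z > s"
      with elim have *: "Re (iter_ln j z) > exp K" by blast
      then have **: "iter_ln j z \<noteq> 0" using exp_gt_zero[of K] by auto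
      have "exp K < norm (iter_ln j z)"
        using * complex_Re_le_cmod[of "iter_ln j z"] by linarith
      then have "ln (exp K) < ln (norm (iter_ln j z))"
        using ** by (subst ln_less_cancel_iff) auto
      then show "K < Re (iter_ln (Suc j) z)"
        using ** by (simp add: iter_ln_Suc Re_Ln)
    qed
  qed
qed

text \<open>Positive real part of each iterate keeps it off the branch cut of the next
  logarithm.\<close>

lemma iter_ln_holomorphic:
  "\<forall>\<^sub>F s in at_top. iter_ln j holomorphic_on {z. Re z > s} \<and> (\<forall>z. Re z > s \<longrightarrow> Re (iter_ln j z) > 0)"
proof (induction j)
  case 0
  have "iter_ln 0 = (\<lambda>z::complex. z)" by (simp add: fun_eq_iff)
  moreover have "\<forall>\<^sub>F s in at_top. \<forall>z. Re z > s \<longrightarrow> Re z > 0"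
    using eventually_ge_at_top[of "0::real"] by eventually_elim auto
  ultimately show ?case by (simp add: holomorphic_on_ident)
next
  case (Suc j)
  show ?case using Suc iter_ln_right_half_plane[of 0 "Suc j"]
  proof eventually_elim
    case (elim s)
    have "iter_ln (Suc j) = (\<lambda>z::complex. ln (iter_ln j z))" by (simp add: fun_eq_iff iter_ln_Suc)
    moreover have "(\<lambda>z. ln (iter_ln j z)) holomorphic_on {z. Re z > s}"
      using elim by (intro holomorphic_intros) (auto simp: complex_nonpos_Reals_iff not_le)
    ultimately show ?case using elim by simp
  qed
qed

lemma holomorphic_on_sum_list:
  "(\<And>x. x \<in> set xs \<Longrightarrow> f x holomorphic_on A) \<Longrightarrow> (\<lambda>z. \<Sum>x\<leftarrow>xs. f x z) holomorphic_on A"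
  by (induction xs) (auto intro: holomorphic_intros)

lemma eval_holomorphic:
  "\<forall>\<^sub>F s in at_top. eval L holomorphic_on {z. Re z > s}"
proof (induction L)
  case (LogExp \<Phi> \<alpha>)
  have "\<forall>\<^sub>F s in at_top. \<forall>p\<in>set \<Phi>. eval (snd p) holomorphic_on {z. Re z > s}"
    using LogExp by (intro eventually_ball_finite) (auto simp: snds.simps)
  moreover have "\<forall>\<^sub>F s in at_top. \<forall>j\<in>{..<length \<alpha>}.
      iter_ln j holomorphic_on {z. Re z > s} \<and> (\<forall>z. Re z > s \<longrightarrow> Re (iter_ln j z) > 0)"
    using iter_ln_holomorphic by (intro eventually_ball_finite) auto
  ultimately show ?case
  proof eventually_elim
    case (elim s)
    have "(\<lambda>z. exp (\<Sum>(c, M)\<leftarrow>\<Phi>. of_real c * eval M z) *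
        (\<Prod>j<length \<alpha>. iter_ln j z powr of_real (\<alpha> ! j))) holomorphic_on {z. Re z > s}"
      using elim
      by (intro holomorphic_intros holomorphic_on_sum_list)
        (auto simp: complex_nonpos_Reals_iff not_le split_beta intro!: holomorphic_intros)
    moreover have "eval (LogExp \<Phi> \<alpha>) = (\<lambda>z::complex. exp (\<Sum>(c, M)\<leftarrow>\<Phi>. of_real c * eval M z) *
        (\<Prod>j<length \<alpha>. iter_ln j z powr of_real (\<alpha> ! j)))"
      by (simp add: fun_eq_iff)
    ultimately show ?case by simp
  qed
qed

lemma iter_ln_of_real:
  "\<forall>\<^sub>F x in at_top. iter_ln j (complex_of_real x) = of_real (iter_ln j x)"
proof (induction j)
  case (Suc j)
  with eventually_iter_ln_pos[of j] show ?case
    by eventually_elim (simp add: iter_ln_Suc Ln_of_real)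
qed simp

text \<open>The real and complex evaluations use different instances of \<open>ln\<close> and
  \<open>powr\<close>; they agree once all iterated logarithms involved are positive. This links a
  real germ to its continuation.\<close>

lemma eval_of_real:
  "\<forall>\<^sub>F x in at_top. eval L (complex_of_real x) = of_real (eval L x)"
proof (induction L)
  case (LogExp \<Phi> \<alpha>)
  have "\<forall>\<^sub>F x in at_top. \<forall>p\<in>set \<Phi>. eval (snd p) (complex_of_real x) = of_real (eval (snd p) x)"
    using LogExp by (intro eventually_ball_finite) (auto simp: snds.simps)
  moreover have "\<forall>\<^sub>F x in at_top. \<forall>j\<in>{..<length \<alpha>}.
      iter_ln j (complex_of_real x) = of_real (iter_ln j x) \<and> iter_ln j x > 0"
    using iter_ln_of_real eventually_iter_ln_pos
    by (intro eventually_ball_finite) (auto simp: eventually_conj_iff)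
  ultimately show ?case
  proof eventually_elim
    case (elim x)
    have "(\<Sum>(c, M)\<leftarrow>\<Phi>. of_real c * eval M (complex_of_real x)) = of_real (\<Sum>(c, M)\<leftarrow>\<Phi>. c * eval M x)"
      using elim(1) by (induction \<Phi>) auto
    moreover have "(\<Prod>j<length \<alpha>. iter_ln j (complex_of_real x) powr of_real (\<alpha> ! j)) =
        of_real (\<Prod>j<length \<alpha>. iter_ln j x powr (\<alpha> ! j))"
      unfolding of_real_prod
    proof (rule prod.cong)
      fix j assume "j \<in> {..<length \<alpha>}"
      then have "iter_ln j (complex_of_real x) = of_real (iter_ln j x)" "iter_ln j x > 0"
        using elim(2) by auto
      then show "iter_ln j (complex_of_real x) powr of_real (\<alpha> ! j) = of_real (iter_ln j x powr (\<alpha> ! j))"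
        by (simp add: powr_of_real)
    qed simp
    ultimately show ?case by (simp add: exp_of_real)
  qed
qed

text \<open>Identity theorem on a half-plane where the expression is holomorphic, applied along the
  real ray. Thus the continuation depends only on the real germ, although it is computed from the
  expression.\<close>

lemma eval_eq_on_half_plane:
  fixes f :: "complex \<Rightarrow> complex" and g :: "real \<Rightarrow> real"
  assumes "germ_eq (eval L) g" and "f holomorphic_on UNIV" and "\<And>x. f (of_real x) = of_real (g x)"
  shows "\<forall>\<^sub>F s in at_top. \<forall>z. Re z > s \<longrightarrow> eval L z = f z"
proof -
  have "\<forall>\<^sub>F x in at_top. eval L (complex_of_real x) = f (of_real x)"
    using assms(1) eval_of_real[of L] unfolding germ_eq_def by eventually_elim (simp add: assms(3))
  then obtain X where X: "\<And>x. x \<ge> X \<Longrightarrow> eval L (complex_of_real x) = f (of_real x)"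
    by (auto simp: eventually_at_top_linorder)
  show ?thesis
    using eval_holomorphic[of L] eventually_ge_at_top[of X]
  proof eventually_elim
    case (elim s)
    let ?S = "{z. Re z > s}"
    \<comment> \<open>The identity theorem needs a limit point inside the open half-plane;
      \<open>s + 1\<close> is an interior point of the ray.\<close>
    have lim: "of_real (s + 1) islimpt complex_of_real ` {s<..}"
      unfolding islimpt_approachable
    proof (intro allI impI)
      fix e :: real assume "e > 0"
      then show "\<exists>x'\<in>complex_of_real ` {s<..}. x' \<noteq> of_real (s + 1) \<and> dist x' (of_real (s + 1)) < e"
        by (intro bexI[of _ "of_real (s + 1 + e / 2)"] conjI)
          (auto simp: dist_of_real dist_real_def simp del: of_real_add of_real_divide)
    qed
    show ?case
    proof (intro allI impI)
      fix z assume "Re z > s"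
      have "eval L z - f z = 0"
      proof (rule analytic_continuation[where f = "\<lambda>z. eval L z - f z" and S = ?S and U = "complex_of_real ` {s<..}" and \<xi> = "of_real (s + 1)"])
        show "(\<lambda>z. eval L z - f z) holomorphic_on ?S"
          using elim assms(2) holomorphic_on_subset by (intro holomorphic_intros) auto
        show "connected ?S" by (simp add: convex_connected convex_halfspace_Re_gt)
      qed (use elim X lim \<open>Re z > s\<close> in \<open>auto simp: open_halfspace_Re_gt\<close>)
      then show "eval L z = f z" by simp
    qed
  qed
qed

section \<open>Gaussian integrals\<close>

text \<open>This is the characteristic function of the standard normal distribution.\<close>

lemma has_bochner_integral_std_normal_iexp:
  "has_bochner_integral lborel (\<lambda>t. complex_of_real (std_normal_density t) * iexp (s * t))
     (of_real (exp (- s\<^sup>2 / 2)))"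
proof -
  have "integrable lborel (\<lambda>t. complex_of_real (std_normal_density t) * iexp (s * t))"
    by (rule Bochner_Integration.integrable_bound[OF integrable_normal_density[of 1 0]])
      (auto simp: norm_mult)
  moreover have "(CLINT t|lborel. complex_of_real (std_normal_density t) * iexp (s * t)) =
      char std_normal_distribution s"
    unfolding char_def by (subst integral_density) (auto simp: scaleR_conv_of_real)
  ultimately show ?thesis
    by (simp add: has_bochner_integral_iff char_std_normal_distribution)
qed

text \<open>Completing the square: exponential tilting shifts the mean of the normal density to
  \<open>a\<close>.\<close>

lemma std_normal_density_exp:
  "std_normal_density u * exp (a * u) = exp (a\<^sup>2 / 2) * normal_density a 1 u"
  by (simp add: normal_density_def mult_exp_exp) (simp add: field_simps power2_eq_square)

lemma has_bochner_integral_std_normal_exp: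
  "has_bochner_integral lborel (\<lambda>u. std_normal_density u * exp (a * u)) (exp (a\<^sup>2 / 2))"
  unfolding std_normal_density_exp by (simp add: has_bochner_integral_iff)

section \<open>Gaussian moments with logistic weight\<close>

definition logistic_moment :: "nat \<Rightarrow> real" where
  "logistic_moment N = (LINT u|lborel. std_normal_density u * exp (real N * u) / (1 + exp u))"

lemma integrable_logistic_moment:
  "integrable lborel (\<lambda>u. std_normal_density u * exp (real N * u) / (1 + exp u))"
proof (rule Bochner_Integration.integrable_bound)
  show "integrable lborel (\<lambda>u. std_normal_density u * exp (real N * u))"
    using has_bochner_integral_std_normal_exp by (simp add: has_bochner_integral_iff)
  show "AE u in lborel. norm (std_normal_density u * exp (real N * u) / (1 + exp u)) \<le>
      norm (std_normal_density u * exp (real N * u))"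
  proof (intro AE_I2)
    fix u :: real
    have "std_normal_density u * exp (real N * u) / (1 + exp u) \<le> std_normal_density u * exp (real N * u) / 1"
      by (intro divide_left_mono) (auto intro: add_pos_pos)
    then show "norm (std_normal_density u * exp (real N * u) / (1 + exp u)) \<le>
      norm (std_normal_density u * exp (real N * u))"
      by (simp add: add_pos_pos abs_of_pos)
  qed
qed simp

lemma logistic_moment_nonneg: "logistic_moment N \<ge> 0"
  unfolding logistic_moment_def by (intro integral_nonneg_AE AE_I2) (simp add: add_pos_pos less_imp_le)

text \<open>The two numerators add up to a multiple of \<open>1 + exp u\<close>, which cancels the
  denominator and leaves a Gaussian exponential moment.\<close>

lemma logistic_moment_Suc: "logistic_moment N + logistic_moment (Suc N) = exp ((real N)\<^sup>2 / 2)"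
proof -
  have "logistic_moment N + logistic_moment (Suc N) =
    (LINT u|lborel. std_normal_density u * exp (real N * u) / (1 + exp u) +
       std_normal_density u * exp (real (Suc N) * u) / (1 + exp u))"
    unfolding logistic_moment_def
    by (rule Bochner_Integration.integral_add[symmetric]) (rule integrable_logistic_moment)+
  also have "(\<lambda>u. std_normal_density u * exp (real N * u) / (1 + exp u) +
       std_normal_density u * exp (real (Suc N) * u) / (1 + exp u)) =
       (\<lambda>u. std_normal_density u * exp (real N * u))"
  proof
    fix u :: real
    have "1 + exp u \<noteq> 0" using exp_gt_zero[of u] by linarith
    moreover have "exp (real (Suc N) * u) = exp (real N * u) * exp u"
      by (simp add: exp_add algebra_simps)
    ultimately show "std_normal_density u * exp (real N * u) / (1 + exp u) +
       std_normal_density u * exp (real (Suc N) * u) / (1 + exp u) = std_normal_density u * exp (real N * u)"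
      unfolding add_divide_distrib[symmetric] by (simp add: divide_eq_eq algebra_simps)
  qed
  also have "(LINT u|lborel. std_normal_density u * exp (real N * u)) = exp ((real N)\<^sup>2 / 2)"
    using has_bochner_integral_std_normal_exp by (simp add: has_bochner_integral_iff)
  finally show ?thesis .
qed

text \<open>The reflection \<open>u \<mapsto> - u\<close> fixes the Gaussian and turns \<open>1 / (1 + exp u)\<close> into
  its complement \<open>exp u / (1 + exp u)\<close>.\<close>

lemma logistic_moment_0: "logistic_moment 0 = 1 / 2"
proof -
  have "logistic_moment 0 =
      (LINT u|lborel. std_normal_density (- u) * exp (real 0 * - u) / (1 + exp (- u)))"
    unfolding logistic_moment_def
    using lborel_integral_real_affine[of "-1" "\<lambda>u. std_normal_density u * exp (real 0 * u) / (1 + exp u)" 0]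
    by simp
  also have "\<dots> = logistic_moment (Suc 0)"
    unfolding logistic_moment_def
  proof (rule Bochner_Integration.integral_cong)
    fix u :: real
    have "exp u > 0" by simp
    then show "std_normal_density (- u) * exp (real 0 * - u) / (1 + exp (- u)) =
        std_normal_density u * exp (real (Suc 0) * u) / (1 + exp u)"
      by (simp add: normal_density_def exp_minus field_simps)
  qed simp
  finally show ?thesis
    using logistic_moment_Suc[of 0] by simp
qed

section \<open>The selector\<close>

text \<open>On the vertical line the exponent splits into a constant, the Gaussian term in
  \<open>t\<close>, and a phase of frequency \<open>\<sigma> - u\<close>, so the integral becomes a
  value of the normal characteristic function.\<close>

lemma bromwich_integrand_gaussian:
  assumes "flat_cont a (Complex \<sigma> t) = exp ((Complex \<sigma> t)\<^sup>2 / 2)"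
  shows "bromwich_integrand a \<sigma> u t =
    of_real (sqrt (2 * pi) * exp (\<sigma>\<^sup>2 / 2 - u * \<sigma>)) * (of_real (std_normal_density t) * iexp ((\<sigma> - u) * t))"
proof -
  have "bromwich_integrand a \<sigma> u t = exp ((Complex \<sigma> t)\<^sup>2 / 2 - of_real u * Complex \<sigma> t)"
    by (simp add: bromwich_integrand_def assms mult_exp_exp)
  also have "(Complex \<sigma> t)\<^sup>2 / 2 - of_real u * Complex \<sigma> t =
      of_real (\<sigma>\<^sup>2 / 2 - u * \<sigma>) + (of_real (- t\<^sup>2 / 2) + \<i> * of_real ((\<sigma> - u) * t))"
    by (simp add: complex_eq_iff power2_eq_square field_simps)
  also have "exp \<dots> = of_real (exp (\<sigma>\<^sup>2 / 2 - u * \<sigma>)) *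
      (of_real (exp (- t\<^sup>2 / 2)) * iexp ((\<sigma> - u) * t))"
    by (simp only: exp_add exp_of_real)
  also have "exp (- t\<^sup>2 / 2) = sqrt (2 * pi) * std_normal_density t"
    by (simp add: std_normal_density_def)
  finally show ?thesis by (simp add: mult_ac)
qed

lemma has_bochner_integral_bromwich_integrand:
  assumes "\<And>t. flat_cont a (Complex \<sigma> t) = exp ((Complex \<sigma> t)\<^sup>2 / 2)"
  shows "has_bochner_integral lborel (bromwich_integrand a \<sigma> u)
    (of_real (2 * pi * std_normal_density u))"
proof -
  have "has_bochner_integral lborel (bromwich_integrand a \<sigma> u)
    (of_real (sqrt (2 * pi) * exp (\<sigma>\<^sup>2 / 2 - u * \<sigma>)) * of_real (exp (- (\<sigma> - u)\<^sup>2 / 2)))"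
    unfolding bromwich_integrand_gaussian[OF assms, abs_def]
    by (intro has_bochner_integral_mult_right has_bochner_integral_std_normal_iexp) 
  \<comment> \<open>The exponents combine to \<open>- u\<^sup>2 / 2\<close>: the abscissa
    \<open>\<sigma>\<close> drops out, which gives independence of the contour.\<close>
  also have "of_real (sqrt (2 * pi) * exp (\<sigma>\<^sup>2 / 2 - u * \<sigma>)) * of_real (exp (- (\<sigma> - u)\<^sup>2 / 2)) =
      complex_of_real (sqrt (2 * pi) * exp (- u\<^sup>2 / 2))"
    unfolding of_real_mult[symmetric] of_real_eq_iff mult.assoc mult_exp_exp
    by (simp add: power2_eq_square field_simps)
  also have "sqrt (2 * pi) * exp (- u\<^sup>2 / 2) = 2 * pi * std_normal_density u"
    using real_sqrt_mult_self[of "2 * pi"] by (simp add: std_normal_density_def field_simps)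
  finally show ?thesis .
qed

lemma bromwich_at_gaussian:
  assumes "\<And>t. flat_cont a (Complex \<sigma> t) = exp ((Complex \<sigma> t)\<^sup>2 / 2)"
  shows "bromwich_at a \<sigma> u = of_real (std_normal_density u)"
  using has_bochner_integral_bromwich_integrand[OF assms, of u]
  by (simp add: bromwich_at_def has_bochner_integral_iff)

lemma bromwich_gaussian:
  assumes "\<forall>\<^sub>F s in at_top. \<forall>z. Re z > s \<longrightarrow> flat_cont a z = exp (z\<^sup>2 / 2)"
  shows "bromwich a u = of_real (std_normal_density u)"
proof -
  obtain s where s: "\<And>z. Re z > s \<Longrightarrow> flat_cont a z = exp (z\<^sup>2 / 2)"
    using eventually_happens[OF assms] by auto
  have *: "\<forall>\<^sub>F \<sigma> in at_top. bromwich_at a \<sigma> u = of_real (std_normal_density u)"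
    using eventually_gt_at_top[of s] by eventually_elim (simp add: s bromwich_at_gaussian)
  show ?thesis
    unfolding bromwich_def
  proof (rule the_equality[where P = "\<lambda>v. \<forall>\<^sub>F \<sigma> in at_top. bromwich_at a \<sigma> u = v", OF *])
    fix v assume "\<forall>\<^sub>F \<sigma> in at_top. bromwich_at a \<sigma> u = v"
    with * have "\<forall>\<^sub>F \<sigma>::real in at_top. v = of_real (std_normal_density u)"
      by eventually_elim simp
    then show "v = of_real (std_normal_density u)" by simp
  qed
qed

lemma bromwich_admissible_gaussian:
  assumes "a \<in> flat_sums"
    and "\<forall>\<^sub>F s in at_top. \<forall>z. Re z > s \<longrightarrow> flat_cont a z = exp (z\<^sup>2 / 2)"
    and "\<forall>\<^sub>F N in sequentially. flat_germ a (real N) = of_real (exp ((real N)\<^sup>2 / 2))"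
  shows "bromwich_admissible a"
proof -
  obtain s where s: "\<And>z. Re z > s \<Longrightarrow> flat_cont a z = exp (z\<^sup>2 / 2)"
    using eventually_happens[OF assms(2)] by auto
  have "has_bochner_integral lborel
      (\<lambda>u. complex_of_real (std_normal_density u) * exp (of_nat N * of_real u)) (of_real (exp ((real N)\<^sup>2 / 2)))" for N
  proof -
    have "has_bochner_integral lborel
      (\<lambda>u. complex_of_real (std_normal_density u * exp (real N * u))) (of_real (exp ((real N)\<^sup>2 / 2)))"
      by (intro has_bochner_integral_of_real has_bochner_integral_std_normal_exp)
    then show ?thesis by (simp add: exp_of_real[symmetric])
  qed
  then have "(\<forall>\<^sub>F N in sequentially.
       integrable lborel (\<lambda>u. complex_of_real (std_normal_density u) * exp (of_nat N * of_real u)) \<and>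
       (LINT u|lborel. complex_of_real (std_normal_density u) * exp (of_nat N * of_real u)) = flat_germ a (real N))"
    using assms(3) by (simp add: has_bochner_integral_iff eventually_mono)
  moreover have "integrable lborel (bromwich_integrand a \<sigma> u)" if "\<sigma> > s" for \<sigma> u
    using has_bochner_integral_bromwich_integrand[of a \<sigma> u] s that by (auto simp: has_bochner_integral_iff)
  moreover have "bromwich_at a \<sigma> u = of_real (std_normal_density u)" if "\<sigma> > s" for \<sigma> u
    using bromwich_at_gaussian s that by auto
  ultimately show ?thesis
    unfolding bromwich_admissible_def using assms(1) by (intro conjI exI[of _ s]) auto
qed

section \<open>The zero germ as trivial phase part\<close>

lemma flat_cont_Nil: "flat_cont [] z = 0"
  by (simp add: flat_cont_def)

lemma bromwich_at_Nil: "bromwich_at [] \<sigma> u = 0"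
  by (simp add: bromwich_at_def bromwich_integrand_def flat_cont_Nil)

lemma bromwich_Nil: "bromwich [] u = 0"
  by (simp add: bromwich_def bromwich_at_Nil)

lemma bromwich_admissible_Nil: "bromwich_admissible []"
  by (simp add: bromwich_admissible_def flat_sums_def growth_chain_def bromwich_at_Nil flat_germ_def
      bromwich_integrand_def[abs_def] flat_cont_Nil)

lemma splus_cut_Nil: "splus_cut [] N = (\<lambda>_. 0)"
  by (simp add: fun_eq_iff splus_cut_def splus_integrand_def bromwich_Nil)

lemma splus_exists_Nil: "splus_exists [] N"
  by (auto simp: splus_exists_def splus_cut_Nil splus_integrand_def[abs_def] bromwich_Nil set_integrable_def)

lemma splus_Nil: "splus [] N = 0"
  unfolding splus_def splus_cut_Nil by (rule tendsto_Lim) auto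

lemma sminus_gaussian:
  assumes "\<forall>\<^sub>F s in at_top. \<forall>z. Re z > s \<longrightarrow> flat_cont a z = exp (z\<^sup>2 / 2)"
  shows "sminus_exists a N" "sminus a N = of_real (logistic_moment N)"
proof -
  have "sminus_integrand a N =
      (\<lambda>u. complex_of_real (std_normal_density u * exp (real N * u) / (1 + exp u)))"
    by (simp add: fun_eq_iff sminus_integrand_def bromwich_gaussian[OF assms] exp_of_real[symmetric])
  then show "sminus_exists a N" "sminus a N = of_real (logistic_moment N)"
    using integrable_logistic_moment[of N]
    by (simp_all only: sminus_exists_def sminus_def logistic_moment_def integral_complex_of_real
        integrable_of_real)
qed

text \<open>The plus part of the phase split is zero and the minus part is the Gaussian germ. The
  expression \<open>L\<close> remains arbitrary because equal germs may come from different
  lists.\<close>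

lemma selector_alternating_gaussian:
  fixes L
  defines "c \<equiv> [(0, 1, Pure L)]"
  assumes "growth_monomial (Pure L)" "germ_eq (eval L) (\<lambda>x::real. exp (x\<^sup>2 / 2))"
  shows "admits_selector c" "selector c N = (-1) ^ N * of_real (logistic_moment N)"
proof -
  have phase: "phase_plus c = []" "phase_minus c = [(1, Pure L)]"
    by (simp_all add: c_def phase_plus_def phase_minus_def)
  have cont: "\<forall>\<^sub>F s in at_top. \<forall>z. Re z > s \<longrightarrow> flat_cont [(1, Pure L)] z = exp (z\<^sup>2 / 2)"
  proof -
    have "(\<lambda>z::complex. exp (z\<^sup>2 / 2)) holomorphic_on UNIV"
      by (intro holomorphic_intros) auto
    moreover have "exp ((complex_of_real x)\<^sup>2 / 2) = of_real (exp (x\<^sup>2 / 2))" for x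
      by (simp add: exp_of_real[symmetric])
    ultimately show ?thesis
      using eval_eq_on_half_plane[OF assms(3)] by (simp add: flat_cont_def)
  qed
  have "\<forall>\<^sub>F N in sequentially. flat_germ [(1, Pure L)] (real N) = of_real (exp ((real N)\<^sup>2 / 2))"
    using eventually_compose_filterlim[OF assms(3)[unfolded germ_eq_def] filterlim_real_sequentially]
    by eventually_elim (simp add: flat_germ_def)
  then have "bromwich_admissible [(1, Pure L)]"
    using cont assms(2) by (intro bromwich_admissible_gaussian) (auto simp: flat_sums_def growth_chain_def)
  then show "admits_selector c"
    by (simp add: admits_selector_def phase bromwich_admissible_Nil splus_exists_Nil sminus_gaussian[OF cont])
  show "selector c N = (-1) ^ N * of_real (logistic_moment N)"
    by (simp add: selector_def phase splus_Nil sminus_gaussian[OF cont])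
qed

section \<open>Alternating moments and the finite part\<close>

lemma alternating_moment_diff:
  "(-1) ^ N * complex_of_real (logistic_moment N) - (-1) ^ Suc N * of_real (logistic_moment (Suc N)) =
     (-1) ^ N * of_real (exp ((real N)\<^sup>2 / 2))"
  unfolding logistic_moment_Suc[symmetric] by (simp add: algebra_simps)

text \<open>Alternating signs turn the difference of consecutive terms into a sum of nonnegative
  moments, so its norm is at least that of the first term and the constant 1 suffices.\<close>

lemma shift_nonresonant_alternating_moment:
  "shift_nonresonant (\<lambda>N. (-1) ^ N * complex_of_real (logistic_moment N))"
proof -
  have "norm ((-1) ^ N * complex_of_real (logistic_moment N)) \<le>
    norm ((-1) ^ N * complex_of_real (logistic_moment N) - (-1) ^ (N + 1) * of_real (logistic_moment (N + 1)))" for N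
  proof -
    have "norm ((-1) ^ N * complex_of_real (logistic_moment N)) = logistic_moment N"
      by (simp add: norm_mult norm_power logistic_moment_nonneg)
    also have "\<dots> \<le> exp ((real N)\<^sup>2 / 2)"
      using logistic_moment_Suc[of N] logistic_moment_nonneg[of "Suc N"] by linarith
    also have "\<dots> = norm ((-1) ^ N * complex_of_real (exp ((real N)\<^sup>2 / 2)))"
      by (simp add: norm_mult norm_power)
    finally show ?thesis
      unfolding Suc_eq_plus1[symmetric] alternating_moment_diff .
  qed
  then show ?thesis
    unfolding shift_nonresonant_def by (intro disjI2 exI[of _ 1]) auto
qed

text \<open>Uniqueness is stated for the selector rather than for \<open>c\<close>, since several
  expressions may interpolate the same sequence.\<close>

lemma interpolates_alternating_gaussian:
  assumes "\<And>N. R N - R (N + 1) = (-1) ^ N * of_real (exp ((real N)\<^sup>2 / 2))"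
  shows "interpolates [(0, 1, Pure gaussian)] R"
    and "interpolates c R \<Longrightarrow> selector c N = (-1) ^ N * of_real (logistic_moment N)"
proof -
  have germ: "germ_eq (eval gaussian) (\<lambda>x::real. exp (x\<^sup>2 / 2))"
    by (simp add: germ_eq_def eval_gaussian_real)
  have "osc_germ [(0, 1, Pure gaussian)] (real N) = R N - R (N + 1)" for N
    unfolding osc_germ_Cons assms by (simp add: osc_germ_def eval_gaussian_real)
  moreover have "selector [(0, 1, Pure gaussian)] = (\<lambda>N. (-1) ^ N * of_real (logistic_moment N))"
    using selector_alternating_gaussian(2)[OF growth_monomial_gaussian germ] by blast
  ultimately show "interpolates [(0, 1, Pure gaussian)] R"
    using growth_monomial_gaussian selector_alternating_gaussian(1)[OF growth_monomial_gaussian germ]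
    by (simp add: interpolates_def osc_sums_def growth_chain_def shift_nonresonant_alternating_moment)
  assume "interpolates c R"
  then have "c \<in> osc_sums"
    and "\<forall>\<^sub>F n in sequentially. osc_germ c (real n) = (-1) ^ n * of_real (exp ((real n)\<^sup>2 / 2))"
    using assms by (simp_all add: interpolates_def)
  then obtain L where "c = [(0, 1, Pure L)]" "growth_monomial (Pure L)"
    "germ_eq (eval L) (\<lambda>x::real. exp (x\<^sup>2 / 2))"
    by (rule osc_germ_alternating_gaussian)
  then show "selector c N = (-1) ^ N * of_real (logistic_moment N)"
    using selector_alternating_gaussian(2) by blast
qed

lemma finite_part_alternating_gaussian:
  assumes diff: "\<And>N. R N - R (N + 1) = (-1) ^ N * of_real (exp ((real N)\<^sup>2 / 2))"
  shows "M_admissible R" "finite_part R = R 0 - 1 / 2"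
proof -
  show "M_admissible R"
    using interpolates_alternating_gaussian(1)[OF diff] by (auto simp: M_admissible_def)
  \<comment> \<open>Both sequences have the same differences at every index, so the constant can be
    read off at 0, where the moment is 1/2.\<close>
  have const: "R N - (-1) ^ N * of_real (logistic_moment N) = R 0 - 1 / 2" for N
  proof (induction N)
    case 0
    then show ?case by (simp add: logistic_moment_0)
  next
    case (Suc N)
    have "R (Suc N) - (-1) ^ Suc N * of_real (logistic_moment (Suc N)) =
        R N - (-1) ^ N * of_real (logistic_moment N)"
      using diff[of N] alternating_moment_diff[of N] by (simp add: algebra_simps)
    with Suc show ?case by simp
  qed
  \<comment> \<open>The differences have nonzero exponential modulus, which selects the second
    branch of \<open>finite_part\<close>.\<close>
  have "\<not> eventually_constant R"
    by (simp add: eventually_constant_def diff[unfolded Suc_eq_plus1[symmetric]])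
  moreover have "(THE v. \<exists>c. interpolates c R \<and> (\<forall>\<^sub>F N in sequentially. R N - selector c N = v)) = R 0 - 1 / 2"
  proof (rule the_equality)
    show "\<exists>c. interpolates c R \<and> (\<forall>\<^sub>F N in sequentially. R N - selector c N = R 0 - 1 / 2)"
      using interpolates_alternating_gaussian[OF diff] const by (intro exI conjI) auto
  next
    fix v assume "\<exists>c. interpolates c R \<and> (\<forall>\<^sub>F N in sequentially. R N - selector c N = v)"
    then show "v = R 0 - 1 / 2"
      using interpolates_alternating_gaussian(2)[OF diff] const by auto
  qed
  ultimately show "finite_part R = R 0 - 1 / 2"
    by (simp add: finite_part_def)
qed

section \<open>C-summation\<close>

lemma normalized_tail_0: "normalized_tail n0 a b I 0 = a n0 * I n0"
  by (simp add: normalized_tail_def)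

text \<open>The normalization makes the tail differences equal to the terms of the series for every
  presentation and solution. This is what makes the resulting value independent of these
  choices.\<close>

lemma normalized_tail_diff:
  assumes pres: "recurrence_presentation c n0 a b \<mu>" and sol: "recurrence_solution n0 a b \<mu> I"
  shows "normalized_tail n0 a b I N - normalized_tail n0 a b I (N + 1) = c N"
proof -
  define P where "P N = (\<Prod>k\<in>{n0..<n0 + N}. - a k / b k)" for N
  have nz: "a n \<noteq> 0" "b n \<noteq> 0" if "n \<ge> n0" for n
    using pres that by (auto simp: recurrence_presentation_def)
  have P_Suc: "P (Suc N) = P N * (- a (n0 + N) / b (n0 + N))" for N
    by (simp add: P_def)
  have P_nz: "P N \<noteq> 0" for N
    using nz by (auto simp: P_def)
  \<comment> \<open>The product in the presentation is, up to sign and boundary factors, inverse to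
    \<open>P N\<close>; each step contributes only a factor -1.\<close>
  have prod: "a (n0 + N) * P N * (\<Prod>j<N. b (n0 + j) / a (n0 + j + 1)) = (-1) ^ N * a n0" for N
  proof (induction N)
    case 0
    show ?case by (simp add: P_def)
  next
    case (Suc N)
    have "a (n0 + Suc N) * P (Suc N) * (\<Prod>j<Suc N. b (n0 + j) / a (n0 + j + 1)) =
        - (a (n0 + N) * P N * (\<Prod>j<N. b (n0 + j) / a (n0 + j + 1)))"
      using nz[of "n0 + N"] nz[of "n0 + Suc N"] by (simp add: P_Suc)
    with Suc show ?case by simp
  qed
  have c: "c N = (-1) ^ N * \<mu> (n0 + N) * (\<Prod>j<N. b (n0 + j) / a (n0 + j + 1))"
    using pres by (simp add: recurrence_presentation_def)
  have "c N * (a (n0 + N) * P N) = (-1) ^ N * \<mu> (n0 + N) * ((-1) ^ N * a n0)"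
    unfolding c prod[symmetric] by (simp add: mult_ac)
  also have "\<dots> = \<mu> (n0 + N) * a n0"
    by (simp add: power_mult_distrib[symmetric] mult_ac flip: power_add)
  finally have cN: "c N = \<mu> (n0 + N) * a n0 / (a (n0 + N) * P N)"
    using nz[of "n0 + N"] P_nz by (simp add: eq_divide_eq)
  have \<mu>: "\<mu> (n0 + N) = a (n0 + N) * I (n0 + N) + b (n0 + N) * I (n0 + Suc N)"
    using sol by (simp add: recurrence_solution_def)
  \<comment> \<open>Substituting the recurrence for \<open>\<mu>\<close> splits the term in two; the
    factor \<open>- a / b\<close> gained by \<open>P (Suc N)\<close> turns the second summand into
    the next tail with a minus sign.\<close>
  have "c N = a n0 * I (n0 + N) / P N - a n0 * I (n0 + Suc N) / P (Suc N)"
    using nz[of "n0 + N"] P_nz[of N] unfolding cN P_Suc \<mu> by (simp add: field_simps)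
  then show ?thesis
    by (simp add: normalized_tail_def P_def)
qed

theorem theorem10p1:
  shows "C_summable (\<lambda>n. (-1) ^ n * exp (of_nat n ^ 2 / 2))
    \<and> C_sum (\<lambda>n. (-1) ^ n * exp (of_nat n ^ 2 / 2)) = 1 / 2"
proof -
  define c :: "nat \<Rightarrow> complex" where "c = (\<lambda>n. (-1) ^ n * exp (of_nat n ^ 2 / 2))"
  have c: "c n = (-1) ^ n * of_real (exp ((real n)\<^sup>2 / 2))" for n
    by (simp add: c_def exp_of_real[symmetric])
  have C_value: "M_admissible (normalized_tail n0 a b I)"
    "a n0 * I n0 - finite_part (normalized_tail n0 a b I) = 1 / 2"
    if "recurrence_presentation c n0 a b \<mu>" "recurrence_solution n0 a b \<mu> I" for n0 a b \<mu> I
    using finite_part_alternating_gaussian[of "normalized_tail n0 a b I"]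
      normalized_tail_diff[OF that, unfolded c] by (simp_all add: normalized_tail_0)
  \<comment> \<open>With \<open>a\<close> and \<open>b\<close> constantly 1, the recurrence is
    exactly the relation between consecutive moments, so the moments solve it and existence
    follows.\<close>
  have "recurrence_presentation c 0 (\<lambda>_. 1) (\<lambda>_. 1) (\<lambda>n. of_real (exp ((real n)\<^sup>2 / 2)))"
    by (simp add: recurrence_presentation_def c)
  moreover have "recurrence_solution 0 (\<lambda>_. 1) (\<lambda>_. 1) (\<lambda>n. of_real (exp ((real n)\<^sup>2 / 2)))
      (\<lambda>n. of_real (logistic_moment n))"
    by (simp add: recurrence_solution_def flip: logistic_moment_Suc)
  ultimately have "C_value c (1 / 2)"
    unfolding C_value_def using C_value by metis
  moreover have "s = 1 / 2" if "C_value c s" for s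
    using that C_value unfolding C_value_def by metis
  ultimately have "C_summable c \<and> C_sum c = 1 / 2"
    unfolding C_summable_def C_sum_def by (blast intro: the_equality)
  then show ?thesis by (simp add: c_def)
qed

end
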